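(* Assume that the semigroup envelope $\mathscr{S}$ is strongly continuous, i.e. $[0,\infty)\to\mathrm{UC}_\kappa$, $t\mapsto\mathscr{S}(t)u$ is continuous for all $u\in\mathrm{UC}_\kappa$. Then, for every $u_0\in\mathrm{UC}_\kappa$, the function $u\colon[0,\infty)\to\mathrm{UC}_\kappa$, $t\mapsto\mathscr{S}(t)u_0$, is a viscosity solution to the abstract initial value problem $$u'(t)=\mathcal{A}u(t)\quad\text{for }t>0,\qquad u(0)=u_0.$$
   Context: Setting: $\Lambda$ is a nonempty set, $(M,d)$ is a separable metric space, and $\kappa\colon M\to(0,\infty)$ is continuous and bounded. $\|u\|_\infty=\sup_{x\in M}|u(x)|$; $\|u\|_\kappa=\|\kappa u\|_\infty$; $\|u\|_{\mathrm{Lip}}=\inf\{L\ge 0: |u(x)-u(y)|\le L d(x,y)\ \forall x,y\in M\}$. $\mathrm{C}_\kappa$ is the space of continuous $u\colon M\to\mathbb{R}$ with $\|u\|_\kappa<\infty$; $\mathrm{Lip}_{\rm b}$ is the space of bounded Lipschitz functions $M\to\mathbb{R}$; $\mathrm{UC}_\kappa$ is the closure of $\mathrm{Lip}_{\rm b}$ in $(\mathrm{C}_\kappa,\|\cdot\|_\kappa)$. Order and inequalities between functions are pointwise. For $u_n,u\in\mathrm{UC}_\kappa$, $u_n\nearrow u$ means $u_n\le u_{n+1}$ for all $n$ and $u_n(x)\to u(x)$ for all $x\in M$. Continuity, differentiability and limits of $\mathrm{UC}_\kappa$-valued maps are w.r.t. $\|\cdot\|_\kappa$. A Feller semigroup is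 a family $T=(T(t))_{t\ge0}$ of possibly nonlinear operators such that (i) $T(t)\colon\mathrm{UC}_\kappa\to\mathrm{UC}_\kappa$ is continuous for all $t\ge 0$; (ii) $T(0)u=u$ and $T(s+t)u=T(s)T(t)u$ for all $s,t\ge0$, $u\in\mathrm{UC}_\kappa$; (iii) each $T(t)$ is monotone and continuous from below, i.e. $u_n\nearrow u$ in $\mathrm{UC}_\kappa$ implies $T(t)u_n\nearrow T(t)u$. Standing assumptions: (A1) for every $\lambda\in\Lambda$, $S_\lambda=(S_\lambda(t))_{t\ge0}$ is a Feller semigroup of linear operators with $S_\lambda(t)1=1$ for all $t\geq 0$; (A2) there are $\alpha,\beta\in\mathbb{R}$ with $\|S_\lambda(t)u\|_\kappa\le e^{\alpha t}\|u\|_\kappa$ and $\|S_\lambda(t)u\|_{\mathrm{Lip}}\le e^{\beta t}\|u\|_{\mathrm{Lip}}$ for all $u\in\mathrm{Lip}_{\rm b}$, $\lambda\in\Lambda$, $t\ge0$. For $h\ge0$, $u\in\mathrm{UC}_\kappa$: $(\mathcal{E}_hu)(x)=\sup_{\lambda\in\Lambda}(S_\lambda(h)u)(x)$; $\mathcal{E}_h$ maps $\mathrm{UC}_\kappa$ to itself. $P$ is the set of finite subsets $\pi\subset[0,\infty)$ with $0\in\pi$, and $P_t=\{\pi\in P:\max\pi=t\}$. For $\pi=\{t_0,\dots,t_m\}$ with $0=t_0<t_1<\dots<t_m$, $m\ge 1$, $\mathcal{E}_\pi u=\mathcal{E}_{t_1-t_0}\cdots\mathcal{E}_{t_m-t_{m-1}}u$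 (composition), and $\mathcal{E}_{\{0\}}u=u$. The semigroup envelope $\mathscr{S}=(\mathscr{S}(t))_{t\ge0}$ is $(\mathscr{S}(t)u)(x)=\sup_{\pi\in P_t}(\mathcal{E}_\pi u)(x)$; it is a Feller semigroup. Generators: $D(A_\lambda)$ is the space of $u\in\mathrm{UC}_\kappa$ for which $A_\lambda u:=\lim_{h\searrow0}\frac{S_\lambda(h)u-u}{h}\in\mathrm{UC}_\kappa$ exists w.r.t. $\|\cdot\|_\kappa$. For $u\in\bigcap_{\lambda\in\Lambda}D(A_\lambda)$ with $\sup_{\lambda\in\Lambda}\|A_\lambda u\|_\kappa<\infty$, put $(\mathcal{A}u)(x):=\sup_{\lambda\in\Lambda}(A_\lambda u)(x)$, $x\in M$. The test class is $$\mathcal{D}:=\Big\{u\in\bigcap_{\lambda\in\Lambda}D(A_\lambda)\,\Big|\,\sup_{\lambda\in\Lambda}\|A_\lambda u\|_\kappa<\infty\text{ and }\lim_{h\searrow0}\Big\|\frac{\mathscr{S}(h)u-u}{h}-\mathcal{A}u\Big\|_\kappa=0\Big\}.$$ Viscosity solution: $u\colon[0,\infty)\to\mathrm{UC}_\kappa$ is a viscosity subsolution (resp. supersolution) to $u'(t)=\mathcal{A}u(t)$, $t>0$, if $u$ is continuous and for every $t>0$, $x\in M$, and every differentiable $\psi\colon(0,\infty)\to\mathrm{UC}_\kappa$ with $\psi(t)\in\mathcal{D}$, $(\psi(t))(x)=(u(t))(x)$ and $\psi(s)\ge u(s)$ (resp. $\psi(s)\le u(s)$) for all $s>0$, one has $(\psi'(t))(x)\le(\mathcal{A}\psi(t))(x)$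 (resp. $(\psi'(t))(x)\ge(\mathcal{A}\psi(t))(x)$). A viscosity solution is a function that is both a sub- and a supersolution; a viscosity solution of the initial value problem additionally satisfies $u(0)=u_0$. *)

theory Defs
  imports "HOL-Analysis.Analysis"
begin

section \<open>Weighted function spaces\<close>

text \<open>
  The metric space is the type \<open>'a\<close>. Norms that may be infinite are valued in \<^typ>\<open>ennreal\<close>,
  so that the infimum over the empty set (a function that is not Lipschitz) is \<open>\<infinity>\<close>.
\<close>

definition sup_norm :: "('a \<Rightarrow> real) \<Rightarrow> ennreal" where
  "sup_norm u = (SUP x. ennreal \<bar>u x\<bar>)"

definition weighted_norm :: "('a \<Rightarrow> real) \<Rightarrow> ('a \<Rightarrow> real) \<Rightarrow> ennreal" where
  "weighted_norm \<kappa> u = sup_norm (\<lambda>x. \<kappa> x * u x)"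

definition Lip_norm :: "('a::metric_space \<Rightarrow> real) \<Rightarrow> ennreal" where
  "Lip_norm u = Inf {ennreal L |L. L-lipschitz_on UNIV u}"

definition C_weighted :: "('a::metric_space \<Rightarrow> real) \<Rightarrow> ('a \<Rightarrow> real) set" where
  "C_weighted \<kappa> = {u. continuous_on UNIV u \<and> weighted_norm \<kappa> u < \<infinity>}"

definition Lip_b :: "('a::metric_space \<Rightarrow> real) set" where
  "Lip_b = {u. bounded (range u) \<and> (\<exists>L. L-lipschitz_on UNIV u)}"

definition weighted_dist :: "('a \<Rightarrow> real) \<Rightarrow> ('a \<Rightarrow> real) \<Rightarrow> ('a \<Rightarrow> real) \<Rightarrow> real" where
  "weighted_dist \<kappa> u v = enn2real (weighted_norm \<kappa> (\<lambda>x. u x - v x))"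

text \<open>The norm topology; see \<open>Metric_space_C_weighted\<close> below.\<close>

definition C_topology :: "('a::metric_space \<Rightarrow> real) \<Rightarrow> ('a \<Rightarrow> real) topology" where
  "C_topology \<kappa> = Metric_space.mtopology (C_weighted \<kappa>) (weighted_dist \<kappa>)"

definition UC :: "('a::metric_space \<Rightarrow> real) \<Rightarrow> ('a \<Rightarrow> real) set" where
  "UC \<kappa> = C_topology \<kappa> closure_of Lip_b"

definition UC_topology :: "('a::metric_space \<Rightarrow> real) \<Rightarrow> ('a \<Rightarrow> real) topology" where
  "UC_topology \<kappa> = subtopology (C_topology \<kappa>) (UC \<kappa>)"

lemma weighted_norm_le_iff:
  assumes "0 \<le> c"
  shows "weighted_norm \<kappa> u \<le> ennreal c \<longleftrightarrow> (\<forall>x. \<bar>\<kappa> x * u x\<bar> \<le> c)"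
  using assms by (simp add: weighted_norm_def sup_norm_def SUP_le_iff)

lemma weighted_norm_triangle:
  "weighted_norm \<kappa> (\<lambda>x. u x + v x) \<le> weighted_norm \<kappa> u + weighted_norm \<kappa> v"
  unfolding weighted_norm_def sup_norm_def
proof (rule SUP_least)
  fix x
  have "ennreal \<bar>\<kappa> x * (u x + v x)\<bar> \<le> ennreal (\<bar>\<kappa> x * u x\<bar> + \<bar>\<kappa> x * v x\<bar>)"
    by (rule ennreal_leI) (simp add: distrib_left abs_triangle_ineq)
  also have "\<dots> = ennreal \<bar>\<kappa> x * u x\<bar> + ennreal \<bar>\<kappa> x * v x\<bar>"
    by (simp add: ennreal_plus)
  also have "\<dots> \<le> (SUP x. ennreal \<bar>\<kappa> x * u x\<bar>) + (SUP x. ennreal \<bar>\<kappa> x * v x\<bar>)"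
    by (intro add_mono SUP_upper UNIV_I)
  finally show "ennreal \<bar>\<kappa> x * (u x + v x)\<bar> \<le> \<dots>" .
qed

lemma weighted_norm_minus: "weighted_norm \<kappa> (\<lambda>x. u x - v x) = weighted_norm \<kappa> (\<lambda>x. v x - u x)"
  unfolding weighted_norm_def sup_norm_def
  by (simp add: abs_mult abs_minus_commute)

lemma weighted_norm_diff_finite:
  assumes "weighted_norm \<kappa> u < \<infinity>" "weighted_norm \<kappa> v < \<infinity>"
  shows "weighted_norm \<kappa> (\<lambda>x. u x - v x) < \<infinity>"
proof -
  have "weighted_norm \<kappa> (\<lambda>x. - v x) = weighted_norm \<kappa> v"
    by (simp add: weighted_norm_def sup_norm_def)
  then show ?thesis
    using weighted_norm_triangle[of \<kappa> u "\<lambda>x. - v x"] assms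
    by (auto simp: less_top[symmetric] top_unique ennreal_add_eq_top intro: le_less_trans)
qed

lemma Metric_space_C_weighted:
  assumes "\<And>x. 0 < \<kappa> x"
  shows "Metric_space (C_weighted \<kappa>) (weighted_dist \<kappa>)"
proof
  fix u v w
  show "0 \<le> weighted_dist \<kappa> u v"
    by (simp add: weighted_dist_def)
  show "weighted_dist \<kappa> u v = weighted_dist \<kappa> v u"
    unfolding weighted_dist_def using weighted_norm_minus[of \<kappa> u v] by simp
  assume u: "u \<in> C_weighted \<kappa>" and v: "v \<in> C_weighted \<kappa>"
  then have fin: "weighted_norm \<kappa> (\<lambda>x. u x - v x) < \<infinity>"
    by (intro weighted_norm_diff_finite) (auto simp: C_weighted_def)
  show "weighted_dist \<kappa> u v = 0 \<longleftrightarrow> u = v"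
  proof
    assume "weighted_dist \<kappa> u v = 0"
    then have "weighted_norm \<kappa> (\<lambda>x. u x - v x) \<le> ennreal 0"
      using fin by (auto simp: weighted_dist_def enn2real_eq_0_iff)
    then have "\<forall>x. \<bar>\<kappa> x * (u x - v x)\<bar> \<le> 0"
      by (subst (asm) weighted_norm_le_iff) auto
    then show "u = v"
      using assms by (auto simp: fun_eq_iff less_imp_neq[symmetric])
  next
    assume "u = v"
    then show "weighted_dist \<kappa> u v = 0"
      by (simp add: weighted_dist_def weighted_norm_def sup_norm_def)
  qed
  assume w: "w \<in> C_weighted \<kappa>"
  have fin': "weighted_norm \<kappa> (\<lambda>x. v x - w x) < \<infinity>"
    using v w by (intro weighted_norm_diff_finite) (auto simp: C_weighted_def)
  have "weighted_norm \<kappa> (\<lambda>x. u x - w x)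
      \<le> weighted_norm \<kappa> (\<lambda>x. u x - v x) + weighted_norm \<kappa> (\<lambda>x. v x - w x)"
    using weighted_norm_triangle[of \<kappa> "\<lambda>x. u x - v x" "\<lambda>x. v x - w x"] by simp
  then have "weighted_dist \<kappa> u w
      \<le> enn2real (weighted_norm \<kappa> (\<lambda>x. u x - v x) + weighted_norm \<kappa> (\<lambda>x. v x - w x))"
    unfolding weighted_dist_def using fin fin' by (intro enn2real_mono) auto
  then show "weighted_dist \<kappa> u w \<le> weighted_dist \<kappa> u v + weighted_dist \<kappa> v w"
    using fin fin' by (simp add: weighted_dist_def enn2real_plus)
qed

lemma topspace_UC_topology:
  assumes "\<And>x. 0 < \<kappa> x"
  shows "topspace (UC_topology \<kappa>) = UC \<kappa>"
  unfolding UC_topology_def UC_def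
  by (simp add: closure_of_subset_topspace inf.absorb2)


section \<open>Feller semigroups\<close>

definition increases_to :: "(nat \<Rightarrow> 'a \<Rightarrow> real) \<Rightarrow> ('a \<Rightarrow> real) \<Rightarrow> bool" where
  "increases_to v u \<longleftrightarrow> (\<forall>n. v n \<le> v (Suc n)) \<and> (\<forall>x. (\<lambda>n. v n x) \<longlonglongrightarrow> u x)"

text \<open>Operator families are total functions; only times \<open>t \<ge> 0\<close> and arguments in \<open>UC \<kappa>\<close> matter.\<close>

definition feller_semigroup ::
  "('a::metric_space \<Rightarrow> real) \<Rightarrow> (real \<Rightarrow> ('a \<Rightarrow> real) \<Rightarrow> ('a \<Rightarrow> real)) \<Rightarrow> bool" where
  "feller_semigroup \<kappa> T \<longleftrightarrow>
     (\<forall>t\<ge>0. continuous_map (UC_topology \<kappa>) (UC_topology \<kappa>) (T t)) \<and>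
     (\<forall>u\<in>UC \<kappa>. T 0 u = u) \<and>
     (\<forall>s\<ge>0. \<forall>t\<ge>0. \<forall>u\<in>UC \<kappa>. T (s + t) u = T s (T t u)) \<and>
     (\<forall>t\<ge>0. mono_on (UC \<kappa>) (T t)) \<and>
     (\<forall>t\<ge>0. \<forall>v u. range v \<subseteq> UC \<kappa> \<and> u \<in> UC \<kappa> \<and> increases_to v u
        \<longrightarrow> increases_to (\<lambda>n. T t (v n)) (T t u))"

definition linear_family ::
  "('a::metric_space \<Rightarrow> real) \<Rightarrow> (real \<Rightarrow> ('a \<Rightarrow> real) \<Rightarrow> ('a \<Rightarrow> real)) \<Rightarrow> bool" where
  "linear_family \<kappa> T \<longleftrightarrow>
     (\<forall>t\<ge>0. \<forall>u\<in>UC \<kappa>. \<forall>v\<in>UC \<kappa>. \<forall>a b.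
        T t (\<lambda>x. a * u x + b * v x) = (\<lambda>x. a * T t u x + b * T t v x))"


section \<open>The semigroup envelope\<close>

definition sup_op ::
  "'l set \<Rightarrow> ('l \<Rightarrow> real \<Rightarrow> ('a \<Rightarrow> real) \<Rightarrow> ('a \<Rightarrow> real)) \<Rightarrow> real \<Rightarrow> ('a \<Rightarrow> real) \<Rightarrow> ('a \<Rightarrow> real)" where
  "sup_op \<Lambda> S h u = (\<lambda>x. SUP l\<in>\<Lambda>. S l h u x)"

fun sup_op_list ::
  "'l set \<Rightarrow> ('l \<Rightarrow> real \<Rightarrow> ('a \<Rightarrow> real) \<Rightarrow> ('a \<Rightarrow> real)) \<Rightarrow> real list \<Rightarrow> ('a \<Rightarrow> real) \<Rightarrow> ('a \<Rightarrow> real)" where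
  "sup_op_list \<Lambda> S (t0 # t1 # ts) u = sup_op \<Lambda> S (t1 - t0) (sup_op_list \<Lambda> S (t1 # ts) u)"
| "sup_op_list \<Lambda> S [t0] u = u"
| "sup_op_list \<Lambda> S [] u = u"

definition sup_op_partition ::
  "'l set \<Rightarrow> ('l \<Rightarrow> real \<Rightarrow> ('a \<Rightarrow> real) \<Rightarrow> ('a \<Rightarrow> real)) \<Rightarrow> real set \<Rightarrow> ('a \<Rightarrow> real) \<Rightarrow> ('a \<Rightarrow> real)" where
  "sup_op_partition \<Lambda> S \<pi> u = sup_op_list \<Lambda> S (sorted_list_of_set \<pi>) u"

definition partitions :: "real \<Rightarrow> real set set" where
  "partitions t = {\<pi>. finite \<pi> \<and> \<pi> \<subseteq> {0..} \<and> 0 \<in> \<pi> \<and> Max \<pi> = t}"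

definition envelope ::
  "'l set \<Rightarrow> ('l \<Rightarrow> real \<Rightarrow> ('a \<Rightarrow> real) \<Rightarrow> ('a \<Rightarrow> real)) \<Rightarrow> real \<Rightarrow> ('a \<Rightarrow> real) \<Rightarrow> ('a \<Rightarrow> real)" where
  "envelope \<Lambda> S t u = (\<lambda>x. SUP \<pi>\<in>partitions t. sup_op_partition \<Lambda> S \<pi> u x)"


section \<open>Generators and test functions\<close>

definition has_generator_value ::
  "('a::metric_space \<Rightarrow> real) \<Rightarrow> (real \<Rightarrow> ('a \<Rightarrow> real) \<Rightarrow> ('a \<Rightarrow> real)) \<Rightarrow> ('a \<Rightarrow> real) \<Rightarrow> ('a \<Rightarrow> real) \<Rightarrow> bool" where
  "has_generator_value \<kappa> T u v \<longleftrightarrow>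
     limitin (UC_topology \<kappa>) (\<lambda>h x. (T h u x - u x) / h) v (at_right 0)"

definition generator_domain ::
  "('a::metric_space \<Rightarrow> real) \<Rightarrow> (real \<Rightarrow> ('a \<Rightarrow> real) \<Rightarrow> ('a \<Rightarrow> real)) \<Rightarrow> ('a \<Rightarrow> real) set" where
  "generator_domain \<kappa> T = {u \<in> UC \<kappa>. \<exists>v. has_generator_value \<kappa> T u v}"

definition generator ::
  "('a::metric_space \<Rightarrow> real) \<Rightarrow> (real \<Rightarrow> ('a \<Rightarrow> real) \<Rightarrow> ('a \<Rightarrow> real)) \<Rightarrow> ('a \<Rightarrow> real) \<Rightarrow> ('a \<Rightarrow> real)" where
  "generator \<kappa> T u = (THE v. has_generator_value \<kappa> T u v)"

definition sup_generator ::
  "('a::metric_space \<Rightarrow> real) \<Rightarrow> 'l set \<Rightarrow> ('l \<Rightarrow> real \<Rightarrow> ('a \<Rightarrow> real) \<Rightarrow> ('a \<Rightarrow> real))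
     \<Rightarrow> ('a \<Rightarrow> real) \<Rightarrow> ('a \<Rightarrow> real)" where
  "sup_generator \<kappa> \<Lambda> S u = (\<lambda>x. SUP l\<in>\<Lambda>. generator \<kappa> (S l) u x)"

text \<open>
  The limit condition is stated with the extended norm because \<open>sup_generator \<kappa> \<Lambda> S u\<close> is not
  required to be an element of \<open>UC \<kappa>\<close>.
\<close>

definition test_class ::
  "('a::metric_space \<Rightarrow> real) \<Rightarrow> 'l set \<Rightarrow> ('l \<Rightarrow> real \<Rightarrow> ('a \<Rightarrow> real) \<Rightarrow> ('a \<Rightarrow> real))
     \<Rightarrow> ('a \<Rightarrow> real) set" where
  "test_class \<kappa> \<Lambda> S =
     {u \<in> (\<Inter>l\<in>\<Lambda>. generator_domain \<kappa> (S l)).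
        (SUP l\<in>\<Lambda>. weighted_norm \<kappa> (generator \<kappa> (S l) u)) < \<infinity> \<and>
        ((\<lambda>h. weighted_norm \<kappa> (\<lambda>x. (envelope \<Lambda> S h u x - u x) / h - sup_generator \<kappa> \<Lambda> S u x))
           \<longlongrightarrow> 0) (at_right 0)}"


section \<open>Viscosity solutions\<close>

definition has_UC_derivative ::
  "('a::metric_space \<Rightarrow> real) \<Rightarrow> (real \<Rightarrow> 'a \<Rightarrow> real) \<Rightarrow> ('a \<Rightarrow> real) \<Rightarrow> real \<Rightarrow> bool" where
  "has_UC_derivative \<kappa> \<psi> v s \<longleftrightarrow>
     limitin (UC_topology \<kappa>) (\<lambda>h x. (\<psi> (s + h) x - \<psi> s x) / h) v (at 0)"

definition differentiable_with ::
  "('a::metric_space \<Rightarrow> real) \<Rightarrow> (real \<Rightarrow> 'a \<Rightarrow> real) \<Rightarrow> (real \<Rightarrow> 'a \<Rightarrow> real) \<Rightarrow> bool" where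
  "differentiable_with \<kappa> \<psi> \<psi>' \<longleftrightarrow> (\<forall>s>0. \<psi> s \<in> UC \<kappa> \<and> has_UC_derivative \<kappa> \<psi> (\<psi>' s) s)"

text \<open>Below, \<open>D\<close> is the class of test functions and \<open>A\<close> the operator in \<open>u' = A u\<close>.\<close>

definition viscosity_subsolution ::
  "('a::metric_space \<Rightarrow> real) \<Rightarrow> ('a \<Rightarrow> real) set \<Rightarrow> (('a \<Rightarrow> real) \<Rightarrow> ('a \<Rightarrow> real))
     \<Rightarrow> (real \<Rightarrow> 'a \<Rightarrow> real) \<Rightarrow> bool" where
  "viscosity_subsolution \<kappa> D A u \<longleftrightarrow>
     continuous_map (top_of_set {0..}) (UC_topology \<kappa>) u \<and>
     (\<forall>t>0. \<forall>x \<psi> \<psi>'.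
        differentiable_with \<kappa> \<psi> \<psi>' \<and> \<psi> t \<in> D \<and> \<psi> t x = u t x \<and> (\<forall>s>0. \<psi> s \<ge> u s)
        \<longrightarrow> \<psi>' t x \<le> A (\<psi> t) x)"

definition viscosity_supersolution ::
  "('a::metric_space \<Rightarrow> real) \<Rightarrow> ('a \<Rightarrow> real) set \<Rightarrow> (('a \<Rightarrow> real) \<Rightarrow> ('a \<Rightarrow> real))
     \<Rightarrow> (real \<Rightarrow> 'a \<Rightarrow> real) \<Rightarrow> bool" where
  "viscosity_supersolution \<kappa> D A u \<longleftrightarrow>
     continuous_map (top_of_set {0..}) (UC_topology \<kappa>) u \<and>
     (\<forall>t>0. \<forall>x \<psi> \<psi>'.
        differentiable_with \<kappa> \<psi> \<psi>' \<and> \<psi> t \<in> D \<and> \<psi> t x = u t x \<and> (\<forall>s>0. \<psi> s \<le> u s)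
        \<longrightarrow> \<psi>' t x \<ge> A (\<psi> t) x)"

definition viscosity_solution ::
  "('a::metric_space \<Rightarrow> real) \<Rightarrow> ('a \<Rightarrow> real) set \<Rightarrow> (('a \<Rightarrow> real) \<Rightarrow> ('a \<Rightarrow> real))
     \<Rightarrow> (real \<Rightarrow> 'a \<Rightarrow> real) \<Rightarrow> bool" where
  "viscosity_solution \<kappa> D A u \<longleftrightarrow>
     viscosity_subsolution \<kappa> D A u \<and> viscosity_supersolution \<kappa> D A u"

definition viscosity_solution_ivp ::
  "('a::metric_space \<Rightarrow> real) \<Rightarrow> ('a \<Rightarrow> real) set \<Rightarrow> (('a \<Rightarrow> real) \<Rightarrow> ('a \<Rightarrow> real))
     \<Rightarrow> ('a \<Rightarrow> real) \<Rightarrow> (real \<Rightarrow> 'a \<Rightarrow> real) \<Rightarrow> bool" where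
  "viscosity_solution_ivp \<kappa> D A u0 u \<longleftrightarrow> viscosity_solution \<kappa> D A u \<and> u 0 = u0"

end

theory Submission
  imports Defs
begin

text \<open>
  Write \<open>T t\<close> for the envelope and \<open>u t = T t u0\<close>. The proof rests on two properties of \<open>T\<close>: it is
  a semigroup, and each \<open>T t\<close> is monotone, sublinear and Lipschitz in the weighted norm with
  constant \<open>exp (\<alpha> * t)\<close>. Suppose that \<open>\<psi>\<close> touches \<open>u\<close> from above at \<open>(t, x)\<close>, and put
  \<open>w h = (\<psi> t - \<psi> (t - h)) / h\<close> for \<open>0 < h < t\<close>. The semigroup law, monotonicity and sublinearity
  give, at the point \<open>x\<close>,

  \<open>\<psi> t = T h (u (t - h)) \<le> T h (\<psi> (t - h)) = T h (\<psi> t - h * w h) \<le> T h (\<psi> t) + h * T h (- w h)\<close>.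

  Hence \<open>0 \<le> (T h (\<psi> t) - \<psi> t) / h + T h (- w h)\<close> at \<open>x\<close>. As \<open>h\<close> decreases to \<open>0\<close>, the first summand
  tends to \<open>sup_generator (\<psi> t)\<close> because \<open>\<psi> t\<close> is a test function, and the second one to \<open>- \<psi>' t\<close>
  because \<open>T\<close> is strongly continuous and the Lipschitz constants of \<open>T h\<close> stay bounded
  (\<open>envelope_tendsto\<close>). This is the subsolution inequality. For \<open>\<psi>\<close> touching from below, the
  decomposition \<open>\<psi> t = \<psi> (t - h) + h * w h\<close> gives the supersolution inequality in the same way.

  The substance lies in the semigroup law \<open>envelope_add\<close>. The inequality
  \<open>T (s + t) u \<le> T s (T t u)\<close> holds because inserting \<open>s\<close> into a partition of \<open>{0..s + t}\<close> can only
  increase the corresponding operator, which then factors into an operator over \<open>{0..s}\<close> and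
  one over \<open>{0..t}\<close>. For the reverse inequality a supremum has to be pulled out of a partition
  operator. Pointwise limits pass through such operators along increasing sequences, so \<open>T t u\<close> has
  to be the limit of an increasing sequence of partition values; separability provides it, by the
  Lindelof property (\<open>directed_sup_attained_by_sequence\<close>).

  All operators involved belong to the class \<open>sublinear_operator\<close>, which contains every
  \<open>S l t\<close> with \<open>l \<in> \<Lambda>\<close> and \<open>t \<ge> 0\<close> and is closed under compositions and under those suprema that
  map \<open>UC \<kappa>\<close> into itself.
\<close>

section \<open>Directed suprema on separable metric spaces\<close>

text \<open>
  The Lindelof property of a separable metric space. Every point of an open set lies in a ball
  of radius \<open>1 / (n + 1)\<close> around a point of the countable dense set that is contained in the open
  set, so one index for each such ball suffices.
\<close>

lemma countable_subfamily_of_open_cover: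
  fixes U :: "'i \<Rightarrow> 'a::metric_space set"
  assumes sep: "separable_space (euclidean :: 'a topology)"
    and opn: "\<And>i. i \<in> I \<Longrightarrow> open (U i)"
    and cov: "\<And>x. \<exists>i\<in>I. x \<in> U i"
  shows "\<exists>J\<subseteq>I. countable J \<and> (\<forall>x. \<exists>i\<in>J. x \<in> U i)"
proof -
  obtain D :: "'a set" where D: "countable D" "closure D = UNIV"
    using sep by (auto simp: separable_space_def)
  define P where "P d n i \<longleftrightarrow> i \<in> I \<and> ball d (1 / real (Suc n)) \<subseteq> U i" for d n i
  define Q where "Q = {p \<in> D \<times> (UNIV :: nat set). \<exists>i. P (fst p) (snd p) i}"
  define J where "J = (\<lambda>p. SOME i. P (fst p) (snd p) i) ` Q"
  have P: "P (fst p) (snd p) (SOME i. P (fst p) (snd p) i)" if "p \<in> Q" for p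
    using that unfolding Q_def by (auto intro: someI_ex)
  have "countable Q"
    unfolding Q_def by (rule countable_subset[of _ "D \<times> UNIV"]) (auto simp: D)
  then have "countable J"
    by (simp add: J_def)
  moreover have "J \<subseteq> I"
    using P by (auto simp: J_def P_def)
  moreover have "\<exists>i\<in>J. x \<in> U i" for x
  proof -
    obtain i where i: "i \<in> I" "x \<in> U i"
      using cov by blast
    then obtain e where e: "0 < e" "ball x e \<subseteq> U i"
      using opn openE by blast
    obtain n where n: "1 / real (Suc n) < e / 2"
      using nat_approx_posE[of "e / 2"] e by auto
    obtain d where d: "d \<in> D" "dist d x < 1 / real (Suc n)"
      using D(2) closure_approachable[of x D] by (metis UNIV_I divide_pos_pos of_nat_0_less_iff zero_less_Suc zero_less_one)
    have "ball d (1 / real (Suc n)) \<subseteq> ball x e"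
    proof
      fix y assume "y \<in> ball d (1 / real (Suc n))"
      then show "y \<in> ball x e"
        using dist_triangle2[of x y d] dist_commute[of y d] dist_commute[of x d] d n by auto
    qed
    then have "(d, n) \<in> Q"
      using i e d by (auto simp: Q_def P_def)
    then have "(SOME i. P d n i) \<in> J"
      unfolding J_def by (rule image_eqI[rotated]) simp
    moreover have "x \<in> U (SOME i. P d n i)"
      using P[OF \<open>(d, n) \<in> Q\<close>] d by (auto simp: P_def)
    ultimately show ?thesis by blast
  qed
  ultimately show ?thesis by blast
qed

text \<open>
  For each \<open>n\<close>, the sets where \<open>f i\<close> is within \<open>1 / (n + 1)\<close> of \<open>g\<close> are open and cover the space, so
  countably many indices approximate \<open>g\<close> arbitrarily well at every point. Directedness then allows
  passing to upper bounds of longer and longer initial segments of an enumeration of these indices.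
\<close>

lemma directed_sup_attained_by_sequence:
  fixes f :: "'i \<Rightarrow> 'a::metric_space \<Rightarrow> real"
  assumes sep: "separable_space (euclidean :: 'a topology)"
    and ne: "I \<noteq> {}"
    and contf: "\<And>i. i \<in> I \<Longrightarrow> continuous_on UNIV (f i)"
    and contg: "continuous_on UNIV g"
    and bdd: "\<And>x. bdd_above ((\<lambda>i. f i x) ` I)"
    and g: "\<And>x. g x = (SUP i\<in>I. f i x)"
    and dir: "\<And>i j. i \<in> I \<Longrightarrow> j \<in> I \<Longrightarrow> \<exists>k\<in>I. f i \<le> f k \<and> f j \<le> f k"
  shows "\<exists>s. range s \<subseteq> I \<and> increases_to (\<lambda>n::nat. f (s n)) g"
proof -
  have "\<exists>J\<subseteq>I. countable J \<and> (\<forall>x. \<exists>i\<in>J. x \<in> {x. g x - f i x < 1 / real (Suc n)})" for n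
  proof (rule countable_subfamily_of_open_cover[OF sep])
    show "open {x. g x - f i x < 1 / real (Suc n)}" if "i \<in> I" for i
      by (intro open_Collect_less continuous_intros contg contf that)
    show "\<exists>i\<in>I. x \<in> {x. g x - f i x < 1 / real (Suc n)}" for x
    proof -
      have "g x - 1 / real (Suc n) < (SUP i\<in>I. f i x)"
        using g by simp
      then obtain i where "i \<in> I" "g x - 1 / real (Suc n) < f i x"
        unfolding less_cSUP_iff[OF ne bdd] by blast
      then show ?thesis
        by (intro bexI[of _ i]) simp_all
    qed
  qed
  then obtain J where J: "\<And>n. J n \<subseteq> I" "\<And>n. countable (J n)"
      "\<And>n x. \<exists>i\<in>J n. g x - f i x < 1 / real (Suc n)"
    by (simp add: Collect_mem_eq) metis
  define K where "K = (\<Union>n. J n)"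
  have K: "countable K" "K \<noteq> {}" "K \<subseteq> I"
    using J(1,2) J(3)[where n = 0 and x = undefined] by (auto simp: K_def)
  define e where "e = from_nat_into K"
  have e: "range e = K"
    using K by (simp add: e_def range_from_nat_into)
  then have eI: "e n \<in> I" for n
    using K by auto
  obtain up where up: "\<And>i j. i \<in> I \<Longrightarrow> j \<in> I \<Longrightarrow> up i j \<in> I \<and> f i \<le> f (up i j) \<and> f j \<le> f (up i j)"
    using dir by metis
  \<comment> \<open>\<open>f (s n)\<close> dominates \<open>f (e 0)\<close>, ..., \<open>f (e n)\<close>.\<close>
  define s where "s = rec_nat (e 0) (\<lambda>n i. up i (e (Suc n)))"
  have s_simps: "s 0 = e 0" "s (Suc n) = up (s n) (e (Suc n))" for n
    by (simp_all add: s_def)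
  have sI: "s n \<in> I" for n
    by (induction n) (use eI up in \<open>auto simp: s_simps\<close>)
  have mono: "f (s n) \<le> f (s (Suc n))" for n
    using up[OF sI eI] by (simp add: s_simps)
  have e_le: "f (e n) \<le> f (s n)" for n
    using up[OF sI eI] by (cases n) (auto simp: s_simps)
  have "(\<lambda>n. f (s n) x) \<longlonglongrightarrow> g x" for x
  proof (rule LIMSEQ_I)
    fix r :: real assume "0 < r"
    then obtain n where n: "1 / real (Suc n) < r"
      using nat_approx_posE by blast
    obtain i where i: "i \<in> J n" "g x - f i x < 1 / real (Suc n)"
      using J(3) by blast
    then have "i \<in> range e"
      using e by (auto simp: K_def)
    then obtain m where m: "e m = i"
      by blast
    have "norm (f (s k) x - g x) < r" if "m \<le> k" for k
    proof -
      have "f (s m) \<le> f (s k)"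
        using lift_Suc_mono_le[of "\<lambda>n. f (s n)"] mono that by blast
      then have "f i x \<le> f (s k) x"
        using e_le[of m] m by (meson le_funD order_trans)
      moreover have "f (s k) x \<le> g x"
        unfolding g by (rule cSUP_upper[OF sI bdd])
      ultimately show ?thesis
        using i n by simp
    qed
    then show "\<exists>m. \<forall>k\<ge>m. norm (f (s k) x - g x) < r" by blast
  qed
  then show ?thesis
    using sI mono by (intro exI[of _ s]) (auto simp: increases_to_def)
qed

section \<open>The weighted spaces through pointwise estimates\<close>

locale weight =
  fixes \<kappa> :: "'a::metric_space \<Rightarrow> real"
  assumes kappa_pos: "0 < \<kappa> x"
    and kappa_cont: "continuous_on UNIV \<kappa>"
    and kappa_bdd: "bounded (range \<kappa>)"
begin

lemma kappa_nonzero [simp]: "\<kappa> x \<noteq> 0"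
  using kappa_pos[of x] by simp

lemma weighted_norm_le_real:
  "0 \<le> c \<Longrightarrow> weighted_norm \<kappa> u \<le> ennreal c \<longleftrightarrow> (\<forall>x. \<kappa> x * \<bar>u x\<bar> \<le> c)"
  using kappa_pos by (simp add: weighted_norm_le_iff abs_mult less_imp_le)

lemma weighted_norm_finite_iff:
  "weighted_norm \<kappa> u < \<infinity> \<longleftrightarrow> (\<exists>c\<ge>0. \<forall>x. \<kappa> x * \<bar>u x\<bar> \<le> c)"
proof
  assume "weighted_norm \<kappa> u < \<infinity>"
  then obtain c where "0 \<le> c" "weighted_norm \<kappa> u = ennreal c"
    by (cases "weighted_norm \<kappa> u") auto
  then show "\<exists>c\<ge>0. \<forall>x. \<kappa> x * \<bar>u x\<bar> \<le> c"
    using weighted_norm_le_real[of c u] by auto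
next
  assume "\<exists>c\<ge>0. \<forall>x. \<kappa> x * \<bar>u x\<bar> \<le> c"
  then obtain c where "0 \<le> c" "weighted_norm \<kappa> u \<le> ennreal c"
    using weighted_norm_le_real by blast
  then show "weighted_norm \<kappa> u < \<infinity>"
    by (auto intro: le_less_trans simp: ennreal_less_top)
qed

lemma weighted_dist_le_iff:
  assumes "u \<in> C_weighted \<kappa>" "v \<in> C_weighted \<kappa>" "0 \<le> c"
  shows "weighted_dist \<kappa> u v \<le> c \<longleftrightarrow> (\<forall>x. \<kappa> x * \<bar>u x - v x\<bar> \<le> c)"
proof -
  have "weighted_norm \<kappa> (\<lambda>x. u x - v x) < \<infinity>"
    using assms by (intro weighted_norm_diff_finite) (auto simp: C_weighted_def)
  then obtain r where "0 \<le> r" "weighted_norm \<kappa> (\<lambda>x. u x - v x) = ennreal r"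
    by (cases "weighted_norm \<kappa> (\<lambda>x. u x - v x)") auto
  then show ?thesis
    using weighted_norm_le_real[OF assms(3), of "\<lambda>x. u x - v x"] assms(3)
    by (simp add: weighted_dist_def)
qed

lemma Lip_b_subset_C_weighted: "Lip_b \<subseteq> C_weighted \<kappa>"
proof
  fix u :: "'a \<Rightarrow> real" assume u: "u \<in> Lip_b"
  obtain b where b: "\<And>x. \<bar>u x\<bar> \<le> b"
    using u by (auto simp: Lip_b_def bounded_iff)
  obtain k where k: "\<And>x. \<bar>\<kappa> x\<bar> \<le> k"
    using kappa_bdd by (auto simp: bounded_iff)
  have "0 \<le> b" "0 \<le> k"
    using b k abs_ge_zero by (meson order_trans)+
  moreover have "\<kappa> x * \<bar>u x\<bar> \<le> k * b" for x
    using b[of x] k[of x] kappa_pos[of x] calculation by (intro mult_mono) auto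
  ultimately have "\<exists>c\<ge>0. \<forall>x. \<kappa> x * \<bar>u x\<bar> \<le> c"
    by (meson mult_nonneg_nonneg)
  then show "u \<in> C_weighted \<kappa>"
    using u lipschitz_on_continuous_on
    by (auto simp: C_weighted_def weighted_norm_finite_iff Lip_b_def simp del: infinity_ennreal_def)
qed

text \<open>
  Convergence in the weighted norm is uniform convergence after multiplication by \<open>\<kappa>\<close>, and a
  continuous weight without zeros can be divided out again.
\<close>

lemma continuous_weighted_limit:
  assumes approx: "\<And>e. 0 < e \<Longrightarrow> \<exists>v. continuous_on UNIV v \<and> (\<forall>x. \<kappa> x * \<bar>u x - v x\<bar> \<le> e)"
  shows "continuous_on UNIV u"
proof -
  obtain v where v: "\<And>n::nat. continuous_on UNIV (v n)"
      "\<And>n x. \<kappa> x * \<bar>u x - v n x\<bar> \<le> 1 / real (Suc n)"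
    using approx[of "1 / real (Suc _)"] by simp metis
  have "uniform_limit UNIV (\<lambda>n x. \<kappa> x * v n x) (\<lambda>x. \<kappa> x * u x) sequentially"
  proof (rule uniform_limitI)
    fix e :: real assume "0 < e"
    then obtain N where N: "1 / real (Suc N) < e"
      using nat_approx_posE by blast
    have "dist (\<kappa> x * v n x) (\<kappa> x * u x) < e" if "N \<le> n" for n x
    proof -
      have "dist (\<kappa> x * v n x) (\<kappa> x * u x) = \<kappa> x * \<bar>u x - v n x\<bar>"
        using kappa_pos[of x]
        by (simp add: dist_real_def abs_minus_commute flip: right_diff_distrib abs_mult_pos')
      also have "\<dots> \<le> 1 / real (Suc n)"
        by (rule v)
      also have "\<dots> \<le> 1 / real (Suc N)"
        using that by (simp add: frac_le)
      finally show ?thesis using N by simp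
    qed
    then show "\<forall>\<^sub>F n in sequentially. \<forall>x\<in>UNIV. dist (\<kappa> x * v n x) (\<kappa> x * u x) < e"
      unfolding eventually_sequentially by blast
  qed
  then have "continuous_on UNIV (\<lambda>x. \<kappa> x * u x)"
    by (rule uniform_limit_theorem[rotated])
       (auto intro!: always_eventually continuous_intros v kappa_cont)
  then have "continuous_on UNIV (\<lambda>x. \<kappa> x * u x / \<kappa> x)"
    by (rule continuous_on_divide[OF _ kappa_cont]) simp
  then show ?thesis
    by simp
qed

text \<open>
  This replaces the topological closure by an estimate between real numbers. The closure is taken
  inside \<open>C_weighted \<kappa>\<close>, but approximability by \<open>Lip_b\<close> already forces continuity and a finite
  weighted norm.
\<close>

lemma UC_iff:
  "u \<in> UC \<kappa> \<longleftrightarrow> (\<forall>e>0. \<exists>v\<in>Lip_b. \<forall>x. \<kappa> x * \<bar>u x - v x\<bar> \<le> e)"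
proof -
  interpret Metric_space "C_weighted \<kappa>" "weighted_dist \<kappa>"
    by (rule Metric_space_C_weighted) (rule kappa_pos)
  have "u \<in> UC \<kappa> \<longleftrightarrow> u \<in> C_weighted \<kappa> \<and> (\<forall>e>0. \<exists>v\<in>Lip_b. weighted_dist \<kappa> u v \<le> e)"
    using Lip_b_subset_C_weighted
    unfolding UC_def C_topology_def metric_closure_of_alt in_mcball by blast
  also have "\<dots> \<longleftrightarrow> u \<in> C_weighted \<kappa> \<and> (\<forall>e>0. \<exists>v\<in>Lip_b. \<forall>x. \<kappa> x * \<bar>u x - v x\<bar> \<le> e)"
    using Lip_b_subset_C_weighted weighted_dist_le_iff[of u]
    by (meson less_imp_le subsetD)
  also have "\<dots> \<longleftrightarrow> (\<forall>e>0. \<exists>v\<in>Lip_b. \<forall>x. \<kappa> x * \<bar>u x - v x\<bar> \<le> e)"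
  proof -
    have "u \<in> C_weighted \<kappa>" if approx: "\<forall>e>0. \<exists>v\<in>Lip_b. \<forall>x. \<kappa> x * \<bar>u x - v x\<bar> \<le> e"
    proof -
      obtain v where v: "v \<in> Lip_b" "\<And>x. \<kappa> x * \<bar>u x - v x\<bar> \<le> 1"
        using approx zero_less_one by blast
      then obtain c where c: "0 \<le> c" "\<And>x. \<kappa> x * \<bar>v x\<bar> \<le> c"
        using Lip_b_subset_C_weighted weighted_norm_finite_iff[of v] by (auto simp: C_weighted_def)
      have "\<kappa> x * \<bar>u x\<bar> \<le> c + 1" for x
      proof -
        have "\<kappa> x * \<bar>u x\<bar> \<le> \<kappa> x * (\<bar>u x - v x\<bar> + \<bar>v x\<bar>)"
          using kappa_pos[of x] by (intro mult_left_mono) auto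
        then show ?thesis
          using v(2)[of x] c(2)[of x] by (simp add: distrib_left)
      qed
      then have "weighted_norm \<kappa> u < \<infinity>"
        unfolding weighted_norm_finite_iff using c by (intro exI[of _ "c + 1"]) auto
      moreover have "continuous_on UNIV u"
      proof (rule continuous_weighted_limit)
        fix e :: real assume "0 < e"
        then obtain v where "v \<in> Lip_b" "\<forall>x. \<kappa> x * \<bar>u x - v x\<bar> \<le> e"
          using approx by blast
        then show "\<exists>v. continuous_on UNIV v \<and> (\<forall>x. \<kappa> x * \<bar>u x - v x\<bar> \<le> e)"
          using Lip_b_subset_C_weighted by (auto simp: C_weighted_def)
      qed
      ultimately show ?thesis by (simp add: C_weighted_def)
    qed
    then show ?thesis by blast
  qed
  finally show ?thesis .
qed

lemma UC_subset_C_weighted: "UC \<kappa> \<subseteq> C_weighted \<kappa>"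
proof -
  interpret Metric_space "C_weighted \<kappa>" "weighted_dist \<kappa>"
    by (rule Metric_space_C_weighted) (rule kappa_pos)
  show ?thesis
    unfolding UC_def C_topology_def using closure_of_subset_topspace by force
qed

lemma UC_continuous: "u \<in> UC \<kappa> \<Longrightarrow> continuous_on UNIV u"
  using UC_subset_C_weighted by (auto simp: C_weighted_def)

lemma UC_bound: "u \<in> UC \<kappa> \<Longrightarrow> \<exists>c\<ge>0. \<forall>x. \<kappa> x * \<bar>u x\<bar> \<le> c"
  using UC_subset_C_weighted weighted_norm_finite_iff[of u] by (auto simp: C_weighted_def)

lemma Lip_b_in_UC: "u \<in> Lip_b \<Longrightarrow> u \<in> UC \<kappa>"
  unfolding UC_iff by (auto intro!: bexI[of _ u])

lemma UC_closed:
  assumes "\<And>e. 0 < e \<Longrightarrow> \<exists>v\<in>UC \<kappa>. \<forall>x. \<kappa> x * \<bar>u x - v x\<bar> \<le> e"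
  shows "u \<in> UC \<kappa>"
  unfolding UC_iff
proof (intro allI impI)
  fix e :: real assume e: "0 < e"
  obtain v where v: "v \<in> UC \<kappa>" "\<And>x. \<kappa> x * \<bar>u x - v x\<bar> \<le> e / 2"
    using assms[of "e / 2"] e by auto
  obtain w where w: "w \<in> Lip_b" "\<And>x. \<kappa> x * \<bar>v x - w x\<bar> \<le> e / 2"
    using v(1)[unfolded UC_iff] e by (meson half_gt_zero)
  have "\<kappa> x * \<bar>u x - w x\<bar> \<le> e" for x
  proof -
    have "\<kappa> x * \<bar>u x - w x\<bar> \<le> \<kappa> x * (\<bar>u x - v x\<bar> + \<bar>v x - w x\<bar>)"
      using kappa_pos[of x] by (intro mult_left_mono) auto
    then show ?thesis
      using v(2)[of x] w(2)[of x] by (simp add: distrib_left)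
  qed
  then show "\<exists>v\<in>Lip_b. \<forall>x. \<kappa> x * \<bar>u x - v x\<bar> \<le> e"
    using w by blast
qed

lemma Lip_b_lincomb:
  assumes "u \<in> Lip_b" "v \<in> Lip_b"
  shows "(\<lambda>x. a * u x + b * v x :: real) \<in> Lip_b"
proof -
  obtain L M where LM: "L-lipschitz_on UNIV u" "M-lipschitz_on UNIV v"
    using assms by (auto simp: Lip_b_def)
  obtain r s where rs: "\<And>x. \<bar>u x\<bar> \<le> r" "\<And>x. \<bar>v x\<bar> \<le> s"
    using assms by (auto simp: Lip_b_def bounded_iff)
  have "(\<bar>a\<bar> * L + \<bar>b\<bar> * M)-lipschitz_on UNIV (\<lambda>x. a * u x + b * v x)"
    using lipschitz_on_add[OF lipschitz_on_cmult_real[OF LM(1), of a] lipschitz_on_cmult_real[OF LM(2), of b]]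
    by (simp add: mult.commute)
  moreover have "\<bar>a * u x + b * v x\<bar> \<le> \<bar>a\<bar> * r + \<bar>b\<bar> * s" for x
  proof -
    have "\<bar>a * u x + b * v x\<bar> \<le> \<bar>a\<bar> * \<bar>u x\<bar> + \<bar>b\<bar> * \<bar>v x\<bar>"
      using abs_triangle_ineq[of "a * u x" "b * v x"] by (simp add: abs_mult)
    then show ?thesis
      using mult_left_mono[OF rs(1)[of x], of "\<bar>a\<bar>"] mult_left_mono[OF rs(2)[of x], of "\<bar>b\<bar>"]
      by auto
  qed
  ultimately show ?thesis
    by (force simp: Lip_b_def bounded_iff)
qed

lemma UC_lincomb:
  assumes "u \<in> UC \<kappa>" "v \<in> UC \<kappa>"
  shows "(\<lambda>x. a * u x + b * v x) \<in> UC \<kappa>"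
  unfolding UC_iff
proof (intro allI impI)
  fix e :: real assume e: "0 < e"
  \<comment> \<open>The summand \<open>1\<close> keeps the denominator positive when \<open>a = b = 0\<close>.\<close>
  define d where "d = e / (\<bar>a\<bar> + \<bar>b\<bar> + 1)"
  have d: "0 < d" "(\<bar>a\<bar> + \<bar>b\<bar>) * d \<le> e"
    using e by (auto simp: d_def field_simps add_pos_nonneg)
  obtain u' where u': "u' \<in> Lip_b" "\<And>x. \<kappa> x * \<bar>u x - u' x\<bar> \<le> d"
    using assms(1)[unfolded UC_iff] d(1) by meson
  obtain v' where v': "v' \<in> Lip_b" "\<And>x. \<kappa> x * \<bar>v x - v' x\<bar> \<le> d"
    using assms(2)[unfolded UC_iff] d(1) by meson
  have "\<kappa> x * \<bar>(a * u x + b * v x) - (a * u' x + b * v' x)\<bar> \<le> e" for x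
  proof -
    have "(a * u x + b * v x) - (a * u' x + b * v' x) = a * (u x - u' x) + b * (v x - v' x)"
      by (simp add: algebra_simps)
    then have "\<bar>(a * u x + b * v x) - (a * u' x + b * v' x)\<bar>
        \<le> \<bar>a\<bar> * \<bar>u x - u' x\<bar> + \<bar>b\<bar> * \<bar>v x - v' x\<bar>"
      by (metis abs_mult abs_triangle_ineq)
    then have "\<kappa> x * \<bar>(a * u x + b * v x) - (a * u' x + b * v' x)\<bar>
        \<le> \<kappa> x * (\<bar>a\<bar> * \<bar>u x - u' x\<bar> + \<bar>b\<bar> * \<bar>v x - v' x\<bar>)"
      using kappa_pos[of x] by (intro mult_left_mono) auto
    also have "\<dots> = \<bar>a\<bar> * (\<kappa> x * \<bar>u x - u' x\<bar>) + \<bar>b\<bar> * (\<kappa> x * \<bar>v x - v' x\<bar>)"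
      by (simp add: algebra_simps)
    also have "\<dots> \<le> \<bar>a\<bar> * d + \<bar>b\<bar> * d"
      by (intro add_mono mult_left_mono u' v') auto
    also have "\<dots> \<le> e"
      using d(2) by (simp add: distrib_right)
    finally show ?thesis .
  qed
  then show "\<exists>w\<in>Lip_b. \<forall>x. \<kappa> x * \<bar>a * u x + b * v x - w x\<bar> \<le> e"
    by (intro bexI[OF _ Lip_b_lincomb[OF u'(1) v'(1), of a b]] allI)
qed

lemma limitin_UC_iff:
  "limitin (UC_topology \<kappa>) f v F \<longleftrightarrow>
     v \<in> UC \<kappa> \<and> (\<forall>\<^sub>F h in F. f h \<in> UC \<kappa>) \<and> (\<forall>e>0. \<forall>\<^sub>F h in F. \<forall>x. \<kappa> x * \<bar>f h x - v x\<bar> \<le> e)"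
proof -
  interpret Metric_space "C_weighted \<kappa>" "weighted_dist \<kappa>"
    by (rule Metric_space_C_weighted) (rule kappa_pos)
  have lim: "limitin (C_topology \<kappa>) f v F \<longleftrightarrow> (\<forall>e>0. \<forall>\<^sub>F h in F. \<forall>x. \<kappa> x * \<bar>f h x - v x\<bar> \<le> e)"
    if v: "v \<in> UC \<kappa>" and f: "\<forall>\<^sub>F h in F. f h \<in> UC \<kappa>"
  proof -
    have v': "v \<in> C_weighted \<kappa>" and f': "\<forall>\<^sub>F h in F. f h \<in> C_weighted \<kappa>"
      using v f UC_subset_C_weighted by (auto elim: eventually_mono)
    have "limitin (C_topology \<kappa>) f v F \<longleftrightarrow> (\<forall>e>0. \<forall>\<^sub>F h in F. weighted_dist \<kappa> (f h) v < e)"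
      using v' f' by (simp add: C_topology_def limitin_metric eventually_conj_iff)
    also have "\<dots> \<longleftrightarrow> (\<forall>e>0. \<forall>\<^sub>F h in F. weighted_dist \<kappa> (f h) v \<le> e)"
    proof (intro iffI allI impI)
      fix e :: real
      assume "\<forall>e>0. \<forall>\<^sub>F h in F. weighted_dist \<kappa> (f h) v < e" "0 < e"
      then show "\<forall>\<^sub>F h in F. weighted_dist \<kappa> (f h) v \<le> e"
        by (auto elim!: allE[of _ e] eventually_mono)
    next
      fix e :: real
      assume "\<forall>e>0. \<forall>\<^sub>F h in F. weighted_dist \<kappa> (f h) v \<le> e" "0 < e"
      then have "\<forall>\<^sub>F h in F. weighted_dist \<kappa> (f h) v \<le> e / 2"
        using half_gt_zero by blast
      then show "\<forall>\<^sub>F h in F. weighted_dist \<kappa> (f h) v < e"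
        by eventually_elim (use \<open>0 < e\<close> in auto)
    qed
    also have "\<dots> \<longleftrightarrow> (\<forall>e>0. \<forall>\<^sub>F h in F. \<forall>x. \<kappa> x * \<bar>f h x - v x\<bar> \<le> e)"
    proof (intro all_cong imp_cong refl)
      fix e :: real assume "0 < e"
      then have "\<forall>\<^sub>F h in F. (weighted_dist \<kappa> (f h) v \<le> e) = (\<forall>x. \<kappa> x * \<bar>f h x - v x\<bar> \<le> e)"
        using f' by (auto elim!: eventually_mono simp: weighted_dist_le_iff[OF _ v'])
      then show "(\<forall>\<^sub>F h in F. weighted_dist \<kappa> (f h) v \<le> e) = (\<forall>\<^sub>F h in F. \<forall>x. \<kappa> x * \<bar>f h x - v x\<bar> \<le> e)"
        by (rule eventually_subst)
    qed
    finally show ?thesis .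
  qed
  show ?thesis
    unfolding UC_topology_def limitin_subtopology using lim by blast
qed

lemma limitin_UC_pointwise:
  assumes "limitin (UC_topology \<kappa>) f v F"
  shows "((\<lambda>h. f h x) \<longlongrightarrow> v x) F"
proof (rule tendstoI)
  fix e :: real assume e: "0 < e"
  then have "0 < \<kappa> x * (e / 2)"
    using kappa_pos by simp
  then have "\<forall>\<^sub>F h in F. \<forall>x'. \<kappa> x' * \<bar>f h x' - v x'\<bar> \<le> \<kappa> x * (e / 2)"
    using assms unfolding limitin_UC_iff by blast
  then show "\<forall>\<^sub>F h in F. dist (f h x) (v x) < e"
  proof eventually_elim
    case (elim h)
    then have "\<bar>f h x - v x\<bar> \<le> e / 2"
      using kappa_pos[of x] by (meson mult_le_cancel_left_pos)
    then show ?case using e by (simp add: dist_real_def)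
  qed
qed

end

section \<open>Sublinear operators\<close>

lemma abs_SUP_diff_le:
  fixes f g :: "'i \<Rightarrow> real"
  assumes ne: "I \<noteq> {}" and bdd: "bdd_above (f ` I)" "bdd_above (g ` I)"
    and le: "\<And>i. i \<in> I \<Longrightarrow> \<bar>f i - g i\<bar> \<le> c"
  shows "\<bar>(SUP i\<in>I. f i) - (SUP i\<in>I. g i)\<bar> \<le> c"
proof -
  have "(SUP i\<in>I. f i) \<le> (SUP i\<in>I. g i) + c"
  proof (rule cSUP_least[OF ne])
    fix i assume "i \<in> I"
    then show "f i \<le> (SUP i\<in>I. g i) + c"
      using le[of i] cSUP_upper[OF _ bdd(2), of i] by auto
  qed
  moreover have "(SUP i\<in>I. g i) \<le> (SUP i\<in>I. f i) + c"
  proof (rule cSUP_least[OF ne])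
    fix i assume "i \<in> I"
    then show "g i \<le> (SUP i\<in>I. f i) + c"
      using le[of i] cSUP_upper[OF _ bdd(1), of i] by auto
  qed
  ultimately show ?thesis by auto
qed

context weight
begin

text \<open>
  The common properties of the semigroup operators, of their suprema, of the operators along a
  partition and of the envelope. The norm bound is stated through upper bounds \<open>c\<close> of the weighted
  norm, which keeps it in the real numbers; the last clause is continuity from below.
\<close>

definition sublinear_operator :: "real \<Rightarrow> (('a \<Rightarrow> real) \<Rightarrow> ('a \<Rightarrow> real)) \<Rightarrow> bool" where
  "sublinear_operator C T \<longleftrightarrow>
     (\<forall>u\<in>UC \<kappa>. T u \<in> UC \<kappa>) \<and>
     mono_on (UC \<kappa>) T \<and>
     (\<forall>u\<in>UC \<kappa>. \<forall>v\<in>UC \<kappa>. \<forall>x. T (\<lambda>x. u x + v x) x \<le> T u x + T v x) \<and>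
     (\<forall>u\<in>UC \<kappa>. \<forall>a\<ge>0. T (\<lambda>x. a * u x) = (\<lambda>x. a * T u x)) \<and>
     (\<forall>u\<in>UC \<kappa>. \<forall>c. (\<forall>x. \<kappa> x * \<bar>u x\<bar> \<le> c) \<longrightarrow> (\<forall>x. \<kappa> x * \<bar>T u x\<bar> \<le> C * c)) \<and>
     (\<forall>v u. range v \<subseteq> UC \<kappa> \<and> u \<in> UC \<kappa> \<and> increases_to v u \<longrightarrow> increases_to (\<lambda>n. T (v n)) (T u))"

lemma
  assumes "sublinear_operator C T"
  shows sublinear_operator_UC: "u \<in> UC \<kappa> \<Longrightarrow> T u \<in> UC \<kappa>"
    and sublinear_operator_mono: "u \<in> UC \<kappa> \<Longrightarrow> v \<in> UC \<kappa> \<Longrightarrow> u \<le> v \<Longrightarrow> T u \<le> T v"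
    and sublinear_operator_add:
      "u \<in> UC \<kappa> \<Longrightarrow> v \<in> UC \<kappa> \<Longrightarrow> T (\<lambda>x. u x + v x) x \<le> T u x + T v x"
    and sublinear_operator_scale: "u \<in> UC \<kappa> \<Longrightarrow> 0 \<le> a \<Longrightarrow> T (\<lambda>x. a * u x) = (\<lambda>x. a * T u x)"
    and sublinear_operator_bound:
      "u \<in> UC \<kappa> \<Longrightarrow> (\<And>x. \<kappa> x * \<bar>u x\<bar> \<le> c) \<Longrightarrow> \<kappa> x * \<bar>T u x\<bar> \<le> C * c"
    and sublinear_operator_from_below:
      "range w \<subseteq> UC \<kappa> \<Longrightarrow> u \<in> UC \<kappa> \<Longrightarrow> increases_to w u \<Longrightarrow> increases_to (\<lambda>n. T (w n)) (T u)"
  using assms unfolding sublinear_operator_def mono_on_def by blast+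

lemma sublinear_operator_diff_le:
  assumes T: "sublinear_operator C T" and u: "u \<in> UC \<kappa>" and v: "v \<in> UC \<kappa>"
  shows "T u x - T v x \<le> T (\<lambda>x. u x - v x) x"
  using sublinear_operator_add[OF T UC_lincomb[OF u v, of 1 "-1"] v, of x] by simp

text \<open>
  Subadditivity, applied to \<open>u = (u - v) + v\<close> and to \<open>v = (v - u) + u\<close>, turns the norm bound into
  a Lipschitz estimate.
\<close>

lemma sublinear_operator_lipschitz:
  assumes T: "sublinear_operator C T" and u: "u \<in> UC \<kappa>" and v: "v \<in> UC \<kappa>"
    and le: "\<And>x. \<kappa> x * \<bar>u x - v x\<bar> \<le> c"
  shows "\<kappa> x * \<bar>T u x - T v x\<bar> \<le> C * c"
proof -
  have bounds: "\<kappa> x * \<bar>T (\<lambda>x. u x - v x) x\<bar> \<le> C * c" "\<kappa> x * \<bar>T (\<lambda>x. v x - u x) x\<bar> \<le> C * c"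
    using UC_lincomb[OF u v, of 1 "-1"] UC_lincomb[OF v u, of 1 "-1"] le
    by (auto intro!: sublinear_operator_bound[OF T] simp: abs_minus_commute)
  have "\<bar>T u x - T v x\<bar> \<le> \<bar>T (\<lambda>x. u x - v x) x\<bar> \<or> \<bar>T u x - T v x\<bar> \<le> \<bar>T (\<lambda>x. v x - u x) x\<bar>"
    using sublinear_operator_diff_le[OF T u v, of x] sublinear_operator_diff_le[OF T v u, of x]
    by linarith
  then show ?thesis
    using bounds kappa_pos[of x] by (meson less_imp_le mult_left_mono order_trans)
qed

lemma sublinear_operator_id: "sublinear_operator 1 (\<lambda>u. u)"
  by (auto simp: sublinear_operator_def mono_on_def)

lemma sublinear_operator_comp:
  assumes S: "sublinear_operator C S" and T: "sublinear_operator D T"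
  shows "sublinear_operator (C * D) (\<lambda>u. S (T u))"
  unfolding sublinear_operator_def
proof (intro conjI ballI allI impI mono_onI)
  fix u v assume u: "u \<in> UC \<kappa>" and v: "v \<in> UC \<kappa>"
  note Tu = sublinear_operator_UC[OF T u] and Tv = sublinear_operator_UC[OF T v]
  have sum: "(\<lambda>x. u x + v x) \<in> UC \<kappa>" "(\<lambda>x. T u x + T v x) \<in> UC \<kappa>"
    using UC_lincomb[OF u v, of 1 1] UC_lincomb[OF Tu Tv, of 1 1] by simp_all
  show "S (T (\<lambda>x. u x + v x)) x \<le> S (T u) x + S (T v) x" for x
  proof -
    have "S (T (\<lambda>x. u x + v x)) \<le> S (\<lambda>x. T u x + T v x)"
      using sublinear_operator_add[OF T u v] sum
      by (intro sublinear_operator_mono[OF S] sublinear_operator_UC[OF T] le_funI)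
    then show ?thesis
      using sublinear_operator_add[OF S Tu Tv, of x] by (meson le_funD order_trans)
  qed
next
  fix u c x assume u: "u \<in> UC \<kappa>" and c: "\<forall>x. \<kappa> x * \<bar>u x\<bar> \<le> c"
  have "\<kappa> x * \<bar>T u x\<bar> \<le> D * c" for x
    using sublinear_operator_bound[OF T u] c by blast
  then show "\<kappa> x * \<bar>S (T u) x\<bar> \<le> C * D * c"
    using sublinear_operator_bound[OF S sublinear_operator_UC[OF T u]] by (simp add: mult.assoc)
next
  fix w u assume "range w \<subseteq> UC \<kappa> \<and> u \<in> UC \<kappa> \<and> increases_to w u"
  then show "increases_to (\<lambda>n. S (T (w n))) (S (T u))"
    by (intro sublinear_operator_from_below[OF S] sublinear_operator_from_below[OF T])
       (auto intro: sublinear_operator_UC[OF T])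
next
  fix u v assume "u \<in> UC \<kappa>" "v \<in> UC \<kappa>" "u \<le> v"
  then show "S (T u) \<le> S (T v)"
    by (intro sublinear_operator_mono[OF S] sublinear_operator_mono[OF T] sublinear_operator_UC[OF T])
next
  fix u and a :: real assume u: "u \<in> UC \<kappa>" and a: "0 \<le> a"
  then show "S (T (\<lambda>x. a * u x)) = (\<lambda>x. a * S (T u) x)"
    by (simp add: sublinear_operator_scale[OF T] sublinear_operator_scale[OF S] sublinear_operator_UC[OF T])
qed (use sublinear_operator_UC[OF S] sublinear_operator_UC[OF T] in blast)

text \<open>
  The common constant makes the family bounded at each point, so that its real-valued supremum
  is a genuine least upper bound.
\<close>

lemma sublinear_operators_bdd_above:
  assumes T: "\<And>i. i \<in> I \<Longrightarrow> sublinear_operator C (T i)" and u: "u \<in> UC \<kappa>"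
  shows "bdd_above ((\<lambda>i. T i u x) ` I)"
proof -
  obtain c where c: "\<And>x. \<kappa> x * \<bar>u x\<bar> \<le> c"
    using UC_bound[OF u] by blast
  have "T i u x \<le> C * c / \<kappa> x" if "i \<in> I" for i
  proof -
    have "\<kappa> x * T i u x \<le> \<kappa> x * \<bar>T i u x\<bar>"
      using kappa_pos[of x] by (intro mult_left_mono) auto
    also have "\<dots> \<le> C * c"
      by (rule sublinear_operator_bound[OF T[OF that] u c])
    finally show ?thesis
      using kappa_pos[of x] by (simp add: pos_le_divide_eq mult.commute)
  qed
  then show ?thesis by (auto intro!: bdd_aboveI2)
qed

text \<open>
  The supremum inherits the common Lipschitz constant in the weighted norm. Its values on \<open>UC \<kappa>\<close>
  are therefore limits of its values on the dense set \<open>Lip_b\<close>.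
\<close>

lemma SUP_in_UC:
  assumes ne: "I \<noteq> {}" and C: "0 < C"
    and T: "\<And>i. i \<in> I \<Longrightarrow> sublinear_operator C (T i)"
    and Lip: "\<And>v. v \<in> Lip_b \<Longrightarrow> (\<lambda>x. SUP i\<in>I. T i v x) \<in> UC \<kappa>"
    and u: "u \<in> UC \<kappa>"
  shows "(\<lambda>x. SUP i\<in>I. T i u x) \<in> UC \<kappa>"
proof (rule UC_closed)
  fix e :: real assume "0 < e"
  then have "0 < e / C"
    using C by simp
  then obtain v where v: "v \<in> Lip_b" "\<And>x. \<kappa> x * \<bar>u x - v x\<bar> \<le> e / C"
    using u[unfolded UC_iff] by meson
  note vUC = Lip_b_in_UC[OF v(1)]
  have "\<kappa> x * \<bar>(SUP i\<in>I. T i u x) - (SUP i\<in>I. T i v x)\<bar> \<le> e" for x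
  proof -
    have "\<bar>(SUP i\<in>I. T i u x) - (SUP i\<in>I. T i v x)\<bar> \<le> e / \<kappa> x"
    proof (rule abs_SUP_diff_le[OF ne sublinear_operators_bdd_above[OF T u] sublinear_operators_bdd_above[OF T vUC]])
      fix i assume "i \<in> I"
      then show "\<bar>T i u x - T i v x\<bar> \<le> e / \<kappa> x"
        using sublinear_operator_lipschitz[OF T u vUC v(2), of i x] kappa_pos[of x] C
        by (simp add: pos_le_divide_eq mult.commute)
    qed
    then show ?thesis
      using kappa_pos[of x] by (simp add: pos_le_divide_eq mult.commute)
  qed
  then show "\<exists>w\<in>UC \<kappa>. \<forall>x. \<kappa> x * \<bar>(SUP i\<in>I. T i u x) - w x\<bar> \<le> e"
    by (intro bexI[OF _ Lip[OF v(1)]] allI)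
qed

text \<open>
  Sublinearity, monotonicity and the bound hold for each member of the family and survive the
  supremum; continuity from below survives because suprema commute with increasing limits.
\<close>

lemma sublinear_operator_SUP:
  assumes ne: "I \<noteq> {}"
    and T: "\<And>i. i \<in> I \<Longrightarrow> sublinear_operator C (T i)"
    and UC: "\<And>u. u \<in> UC \<kappa> \<Longrightarrow> (\<lambda>x. SUP i\<in>I. T i u x) \<in> UC \<kappa>"
  shows "sublinear_operator C (\<lambda>u x. SUP i\<in>I. T i u x)"
proof -
  have bdd: "bdd_above ((\<lambda>i. T i u x) ` I)" if "u \<in> UC \<kappa>" for u x
    by (rule sublinear_operators_bdd_above[OF T that])
  show ?thesis
    unfolding sublinear_operator_def
  proof (intro conjI ballI allI impI mono_onI)
    fix u v assume u: "u \<in> UC \<kappa>" and v: "v \<in> UC \<kappa>"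
    show "(SUP i\<in>I. T i (\<lambda>x. u x + v x) x) \<le> (SUP i\<in>I. T i u x) + (SUP i\<in>I. T i v x)" for x
    proof (rule cSUP_least[OF ne])
      fix i assume i: "i \<in> I"
      show "T i (\<lambda>x. u x + v x) x \<le> (SUP i\<in>I. T i u x) + (SUP i\<in>I. T i v x)"
        using sublinear_operator_add[OF T[OF i] u v, of x]
          cSUP_upper[OF i bdd[OF u, of x]] cSUP_upper[OF i bdd[OF v, of x]] by force
    qed
  next
    fix u c x assume u: "u \<in> UC \<kappa>" and c: "\<forall>x. \<kappa> x * \<bar>u x\<bar> \<le> c"
    have "\<bar>T i u x - 0\<bar> \<le> C * c / \<kappa> x" if "i \<in> I" for i
      using sublinear_operator_bound[OF T[OF that] u, of c x] c kappa_pos[of x]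
      by (simp add: pos_le_divide_eq mult.commute)
    then have "\<bar>(SUP i\<in>I. T i u x) - (SUP i\<in>I. 0)\<bar> \<le> C * c / \<kappa> x"
      by (intro abs_SUP_diff_le[OF ne bdd[OF u]]) auto
    then show "\<kappa> x * \<bar>SUP i\<in>I. T i u x\<bar> \<le> C * c"
      using kappa_pos[of x] ne by (simp add: pos_le_divide_eq mult.commute)
  next
    fix w u assume "range w \<subseteq> UC \<kappa> \<and> u \<in> UC \<kappa> \<and> increases_to w u"
    then have w: "\<And>n. w n \<in> UC \<kappa>" and u: "u \<in> UC \<kappa>" and inc: "increases_to w u" by auto
    have inci: "increases_to (\<lambda>n. T i (w n)) (T i u)" if "i \<in> I" for i
      using sublinear_operator_from_below[OF T[OF that] _ u inc] w by auto
    have le: "(SUP i\<in>I. T i (w n) x) \<le> (SUP i\<in>I. T i (w (Suc n)) x)" for n x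
      using inci by (intro cSUP_mono[OF ne bdd[OF w]]) (auto simp: increases_to_def le_fun_def)
    have "(\<lambda>n. SUP i\<in>I. T i (w n) x) \<longlonglongrightarrow> (SUP i\<in>I. T i u x)" for x
    proof -
      have up: "(SUP i\<in>I. T i (w n) x) \<le> (SUP i\<in>I. T i u x)" for n
      proof (rule cSUP_mono[OF ne bdd[OF u]])
        fix i assume i: "i \<in> I"
        have "incseq (\<lambda>n. T i (w n) x)"
          using inci[OF i] by (auto simp: increases_to_def le_fun_def intro: incseq_SucI)
        then have "T i (w n) x \<le> T i u x"
          using inci[OF i] by (auto simp: increases_to_def intro: incseq_le)
        then show "\<exists>m\<in>I. T i (w n) x \<le> T m u x"
          using i by blast
      qed
      obtain l where l: "(\<lambda>n. SUP i\<in>I. T i (w n) x) \<longlonglongrightarrow> l"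
        using incseq_convergent[of "\<lambda>n. SUP i\<in>I. T i (w n) x"] le up incseq_SucI by metis
      have "l \<le> (SUP i\<in>I. T i u x)"
        using l up by (intro LIMSEQ_le_const2) auto
      moreover have "(SUP i\<in>I. T i u x) \<le> l"
      proof (rule cSUP_least[OF ne])
        fix i assume i: "i \<in> I"
        show "T i u x \<le> l"
        proof (rule LIMSEQ_le[OF _ l])
          show "(\<lambda>n. T i (w n) x) \<longlonglongrightarrow> T i u x"
            using inci[OF i] by (simp add: increases_to_def)
          show "\<exists>N. \<forall>n\<ge>N. T i (w n) x \<le> (SUP i\<in>I. T i (w n) x)"
            using cSUP_upper[OF i bdd[OF w]] by blast
        qed
      qed
      ultimately show ?thesis using l by simp
    qed
    then show "increases_to (\<lambda>n x. SUP i\<in>I. T i (w n) x) (\<lambda>x. SUP i\<in>I. T i u x)"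
      using le by (simp add: increases_to_def le_fun_def)
  next
    fix u v assume u: "u \<in> UC \<kappa>" and v: "v \<in> UC \<kappa>" and "u \<le> v"
    then have "T i u x \<le> T i v x" if "i \<in> I" for i x
      using sublinear_operator_mono[OF T[OF that] u v] by (simp add: le_fun_def)
    then show "(\<lambda>x. SUP i\<in>I. T i u x) \<le> (\<lambda>x. SUP i\<in>I. T i v x)"
      by (intro le_funI cSUP_mono[OF ne bdd[OF v]]) auto
  next
    fix u and a :: real assume u: "u \<in> UC \<kappa>" and a: "0 \<le> a"
    show "(\<lambda>x. SUP i\<in>I. T i (\<lambda>x. a * u x) x) = (\<lambda>x. a * (SUP i\<in>I. T i u x))"
    proof
      fix x
      have "(SUP i\<in>I. T i (\<lambda>x. a * u x) x) = (SUP i\<in>I. a * T i u x)"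
        using sublinear_operator_scale[OF T u a] by (intro SUP_cong) auto
      also have "\<dots> = a * (SUP i\<in>I. T i u x)"
        using continuous_at_Sup_mono[of "\<lambda>y. a * y" "(\<lambda>i. T i u x) ` I"] a ne bdd[OF u, of x]
        by (simp add: image_image mono_def mult_left_mono continuous_intros)
      finally show "(SUP i\<in>I. T i (\<lambda>x. a * u x) x) = a * (SUP i\<in>I. T i u x)" .
    qed
  qed (rule UC)
qed

end

section \<open>Operators along partitions\<close>

lemma sup_op_list_append:
  "sup_op_list \<Lambda> S (xs @ s # ys) u = sup_op_list \<Lambda> S (xs @ [s]) (sup_op_list \<Lambda> S (s # ys) u)"
  by (induction xs rule: induct_list012) simp_all

lemma sup_op_list_shift: "sup_op_list \<Lambda> S (map ((+) c) ts) u = sup_op_list \<Lambda> S ts u"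
  by (induction ts rule: induct_list012) simp_all

lemma partitions_hd_last:
  assumes "\<pi> \<in> partitions t"
  shows "sorted_list_of_set \<pi> \<noteq> []" "hd (sorted_list_of_set \<pi>) = 0" "last (sorted_list_of_set \<pi>) = t"
proof -
  have \<pi>: "finite \<pi>" "\<pi> \<subseteq> {0..}" "0 \<in> \<pi>" "Max \<pi> = t"
    using assms by (auto simp: partitions_def)
  then show ne: "sorted_list_of_set \<pi> \<noteq> []"
    by auto
  have "Min \<pi> = 0"
    using \<pi> by (intro Min_eqI) auto
  then show "hd (sorted_list_of_set \<pi>) = 0"
    using \<pi> by (subst sorted_list_of_set_nonempty) auto
  have "x \<le> last (sorted_list_of_set \<pi>)" if x: "x \<in> set (sorted_list_of_set \<pi>)" for x
  proof -
    obtain i where i: "i < length (sorted_list_of_set \<pi>)" "sorted_list_of_set \<pi> ! i = x"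
      using x[unfolded in_set_conv_nth] by blast
    have "sorted_list_of_set \<pi> ! i \<le> sorted_list_of_set \<pi> ! (length (sorted_list_of_set \<pi>) - 1)"
      using i(1) by (intro sorted_nth_mono[OF sorted_sorted_list_of_set]) linarith+
    then show ?thesis
      unfolding last_conv_nth[OF ne] i(2) .
  qed
  then have "Max \<pi> = last (sorted_list_of_set \<pi>)"
    using \<pi>(1) last_in_set[OF ne] by (intro Max_eqI) (simp_all add: set_sorted_list_of_set)
  then show "last (sorted_list_of_set \<pi>) = t"
    using \<pi> by simp
qed

lemma partitions_le: "\<pi> \<in> partitions t \<Longrightarrow> x \<in> \<pi> \<Longrightarrow> 0 \<le> x \<and> x \<le> t"
  by (auto simp: partitions_def)

lemma partitions_right: "\<pi> \<in> partitions t \<Longrightarrow> t \<in> \<pi>"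
  using Max_in[of \<pi>] by (auto simp: partitions_def)

lemma partitions_Un:
  assumes "\<pi> \<in> partitions t" "finite F" "F \<subseteq> {0..t}"
  shows "\<pi> \<union> F \<in> partitions t"
proof -
  have "Max (\<pi> \<union> F) = t"
    using assms partitions_right[OF assms(1)] partitions_le[OF assms(1)]
    by (intro Max_eqI) (auto simp: partitions_def)
  then show ?thesis
    using assms by (auto simp: partitions_def)
qed

lemma partitions_nonempty: "0 \<le> t \<Longrightarrow> partitions t \<noteq> {}"
  by (auto simp: partitions_def intro!: exI[of _ "{0, t}"] Max_eqI)

lemma partitions_0: "partitions 0 = {{0}}"
proof -
  have "\<pi> = {0}" if "\<pi> \<in> partitions 0" for \<pi>
    using partitions_le[OF that] that by (fastforce simp: partitions_def intro: order_antisym)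
  moreover have "{0} \<in> partitions 0"
    by (simp add: partitions_def)
  ultimately show ?thesis
    by blast
qed

text \<open>
  Concatenation of partitions corresponds to composition of operators: \<open>\<sigma>\<close>, moved by \<open>s\<close>, is glued to
  the right end of \<open>\<rho>\<close>, and only the step sizes enter the operator.
\<close>

lemma sup_op_partition_concat:
  assumes \<rho>: "\<rho> \<in> partitions s" and \<sigma>: "\<sigma> \<in> partitions t"
  shows "\<rho> \<union> (+) s ` \<sigma> \<in> partitions (s + t)"
    and "sup_op_partition \<Lambda> S (\<rho> \<union> (+) s ` \<sigma>) u = sup_op_partition \<Lambda> S \<rho> (sup_op_partition \<Lambda> S \<sigma> u)"
proof -
  have fin: "finite \<rho>" "finite \<sigma>" and s: "s \<in> \<rho>" "0 \<le> s" and t: "t \<in> \<sigma>" "0 \<le> t"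
    using partitions_right[OF \<rho>] partitions_right[OF \<sigma>] partitions_le[OF \<rho>] partitions_le[OF \<sigma>] assms
    by (auto simp: partitions_def)
  have "x \<le> s + t" if "x \<in> \<rho> \<union> (+) s ` \<sigma>" for x
    using that partitions_le[OF \<rho>, of x] partitions_le[OF \<sigma>] t by fastforce
  then have "Max (\<rho> \<union> (+) s ` \<sigma>) = s + t"
    using fin t by (intro Max_eqI) auto
  then show "\<rho> \<union> (+) s ` \<sigma> \<in> partitions (s + t)"
    using assms s by (auto simp: partitions_def)
  define xs where "xs = butlast (sorted_list_of_set \<rho>)"
  define ys where "ys = tl (sorted_list_of_set \<sigma>)"
  have xs: "sorted_list_of_set \<rho> = xs @ [s]" and ys: "sorted_list_of_set \<sigma> = 0 # ys"
    using partitions_hd_last[OF \<rho>] partitions_hd_last[OF \<sigma>]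
    by (metis xs_def append_butlast_last_id, metis ys_def list.collapse)
  have "sorted_wrt (<) (xs @ [s])" "sorted_wrt (<) (0 # ys)"
    using strict_sorted_list_of_set[of \<rho>] strict_sorted_list_of_set[of \<sigma>] xs ys by auto
  then have "sorted_wrt (<) (xs @ s # map ((+) s) ys)"
    by (fastforce simp: sorted_wrt_append sorted_wrt_map)
  moreover have "set (xs @ s # map ((+) s) ys) = \<rho> \<union> (+) s ` \<sigma>"
    using set_sorted_list_of_set[OF fin(1)] set_sorted_list_of_set[OF fin(2)] xs ys by auto
  ultimately have "sorted_list_of_set (\<rho> \<union> (+) s ` \<sigma>) = xs @ s # map ((+) s) ys"
    using fin by (intro strict_sorted_equal) (auto simp: strict_sorted_list_of_set)
  moreover have "sup_op_list \<Lambda> S (s # map ((+) s) ys) u = sup_op_list \<Lambda> S (0 # ys) u"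
    using sup_op_list_shift[of \<Lambda> S s "0 # ys" u] by simp
  ultimately show "sup_op_partition \<Lambda> S (\<rho> \<union> (+) s ` \<sigma>) u
      = sup_op_partition \<Lambda> S \<rho> (sup_op_partition \<Lambda> S \<sigma> u)"
    by (simp add: sup_op_partition_def xs ys sup_op_list_append[of _ _ xs s "map _ ys"])
qed

lemma partitions_split:
  assumes \<pi>: "\<pi> \<in> partitions (s + t)" and s: "s \<in> \<pi>" and t: "0 \<le> t"
  obtains \<rho> \<sigma> where "\<rho> \<in> partitions s" "\<sigma> \<in> partitions t" "\<pi> = \<rho> \<union> (+) s ` \<sigma>"
proof
  have fin: "finite \<pi>" and zero: "0 \<in> \<pi>"
    using \<pi> by (simp_all add: partitions_def)
  have st: "s + t \<in> \<pi>" and s0: "0 \<le> s"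
    using partitions_right[OF \<pi>] partitions_le[OF \<pi> s] by simp_all
  have "Max {x \<in> \<pi>. x \<le> s} = s"
    using fin s by (intro Max_eqI) auto
  then show "{x \<in> \<pi>. x \<le> s} \<in> partitions s"
    using fin zero s0 partitions_le[OF \<pi>] by (simp add: partitions_def subset_iff)
  have "Max ((\<lambda>x. x - s) ` {x \<in> \<pi>. s \<le> x}) = t"
  proof (rule Max_eqI)
    show "y \<le> t" if "y \<in> (\<lambda>x. x - s) ` {x \<in> \<pi>. s \<le> x}" for y
      using that partitions_le[OF \<pi>] by fastforce
    show "t \<in> (\<lambda>x. x - s) ` {x \<in> \<pi>. s \<le> x}"
      using st t by (intro image_eqI[of _ _ "s + t"]) auto
  qed (use fin in simp)
  moreover have "0 \<in> (\<lambda>x. x - s) ` {x \<in> \<pi>. s \<le> x}"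
    using s by (intro image_eqI[of _ _ s]) auto
  moreover have "(\<lambda>x. x - s) ` {x \<in> \<pi>. s \<le> x} \<subseteq> {0..}"
    by auto
  ultimately show "(\<lambda>x. x - s) ` {x \<in> \<pi>. s \<le> x} \<in> partitions t"
    using fin by (simp add: partitions_def)
  show "\<pi> = {x \<in> \<pi>. x \<le> s} \<union> (+) s ` (\<lambda>x. x - s) ` {x \<in> \<pi>. s \<le> x}"
    by (simp add: image_image) auto
qed

lemma envelope_0: "envelope \<Lambda> S 0 u = u"
  by (simp add: envelope_def partitions_0 sup_op_partition_def)

section \<open>Suprema of linear semigroups\<close>

locale markov_family = weight \<kappa>
  for \<kappa> :: "'a::metric_space \<Rightarrow> real" +
  fixes \<Lambda> :: "'l set"
    and S :: "'l \<Rightarrow> real \<Rightarrow> ('a \<Rightarrow> real) \<Rightarrow> ('a \<Rightarrow> real)"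
    and \<alpha> \<beta> :: real
  assumes nonempty: "\<Lambda> \<noteq> {}"
    and S_feller: "l \<in> \<Lambda> \<Longrightarrow> feller_semigroup \<kappa> (S l)"
    and S_linear: "l \<in> \<Lambda> \<Longrightarrow> linear_family \<kappa> (S l)"
    and S_one: "l \<in> \<Lambda> \<Longrightarrow> 0 \<le> t \<Longrightarrow> S l t (\<lambda>x. 1) = (\<lambda>x. 1)"
    and norm_growth: "l \<in> \<Lambda> \<Longrightarrow> 0 \<le> t \<Longrightarrow> u \<in> Lip_b \<Longrightarrow>
          weighted_norm \<kappa> (S l t u) \<le> ennreal (exp (\<alpha> * t)) * weighted_norm \<kappa> u"
    and Lip_growth: "l \<in> \<Lambda> \<Longrightarrow> 0 \<le> t \<Longrightarrow> u \<in> Lip_b \<Longrightarrow>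
          Lip_norm (S l t u) \<le> ennreal (exp (\<beta> * t)) * Lip_norm u"
begin

lemma S_UC: "l \<in> \<Lambda> \<Longrightarrow> 0 \<le> t \<Longrightarrow> u \<in> UC \<kappa> \<Longrightarrow> S l t u \<in> UC \<kappa>"
  using S_feller[of l] continuous_map_image_subset_topspace[of "UC_topology \<kappa>" "UC_topology \<kappa>" "S l t"]
  by (auto simp: feller_semigroup_def topspace_UC_topology[OF kappa_pos])

lemma S_mono: "l \<in> \<Lambda> \<Longrightarrow> 0 \<le> t \<Longrightarrow> u \<in> UC \<kappa> \<Longrightarrow> v \<in> UC \<kappa> \<Longrightarrow> u \<le> v \<Longrightarrow> S l t u \<le> S l t v"
  using S_feller[of l] by (auto simp: feller_semigroup_def mono_on_def)

lemma S_lincomb: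
  "l \<in> \<Lambda> \<Longrightarrow> 0 \<le> t \<Longrightarrow> u \<in> UC \<kappa> \<Longrightarrow> v \<in> UC \<kappa> \<Longrightarrow>
    S l t (\<lambda>x. a * u x + b * v x) = (\<lambda>x. a * S l t u x + b * S l t v x)"
  using S_linear[of l] by (auto simp: linear_family_def)

lemma const_in_Lip_b: "(\<lambda>x. c) \<in> Lip_b"
  by (auto simp: Lip_b_def intro!: exI[of _ 0] lipschitz_intros)

lemma S_const: "l \<in> \<Lambda> \<Longrightarrow> 0 \<le> t \<Longrightarrow> S l t (\<lambda>x. c) = (\<lambda>x. c)"
  using S_lincomb[of l t "\<lambda>x. 1" "\<lambda>x. 1" c 0] Lip_b_in_UC[OF const_in_Lip_b, of 1] S_one[of l t] by simp

text \<open>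
  The growth bound for \<open>Lip_b\<close> passes to the closure \<open>UC \<kappa>\<close> because \<open>S l t\<close> is continuous.
\<close>

lemma S_bound:
  assumes l: "l \<in> \<Lambda>" and t: "0 \<le> t" and u: "u \<in> UC \<kappa>" and c: "\<And>x. \<kappa> x * \<bar>u x\<bar> \<le> c"
  shows "\<kappa> x * \<bar>S l t u x\<bar> \<le> exp (\<alpha> * t) * c"
proof -
  obtain v where v: "\<And>n. v n \<in> Lip_b" "\<And>n x. \<kappa> x * \<bar>u x - v n x\<bar> \<le> 1 / real (Suc n)"
    using u[unfolded UC_iff, rule_format, of "1 / real (Suc _)"] by simp metis
  have "limitin (UC_topology \<kappa>) v u sequentially"
    unfolding limitin_UC_iff
  proof (intro conjI allI impI)
    fix e :: real assume "0 < e"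
    then obtain N where N: "1 / real (Suc N) < e"
      using nat_approx_posE by blast
    have "\<kappa> x * \<bar>v n x - u x\<bar> \<le> e" if "N \<le> n" for n x
    proof -
      have "1 / real (Suc n) \<le> 1 / real (Suc N)"
        using that by (simp add: frac_le)
      then show ?thesis
        using v(2)[of x n] N by (simp add: abs_minus_commute)
    qed
    then show "\<forall>\<^sub>F n in sequentially. \<forall>x. \<kappa> x * \<bar>v n x - u x\<bar> \<le> e"
      unfolding eventually_sequentially by blast
  qed (use u v Lip_b_in_UC in auto)
  then have "limitin (UC_topology \<kappa>) (S l t \<circ> v) (S l t u) sequentially"
    using S_feller[OF l] t by (intro continuous_map_limit) (auto simp: feller_semigroup_def)
  then have lim: "(\<lambda>n. \<kappa> x * \<bar>S l t (v n) x\<bar>) \<longlonglongrightarrow> \<kappa> x * \<bar>S l t u x\<bar>"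
    by (intro tendsto_intros) (use limitin_UC_pointwise in fastforce)
  have lim': "(\<lambda>n. exp (\<alpha> * t) * (c + 1 / real (Suc n))) \<longlonglongrightarrow> exp (\<alpha> * t) * (c + 0)"
    by (intro tendsto_intros LIMSEQ_Suc[OF lim_1_over_n])
  have "\<kappa> x * \<bar>S l t (v n) x\<bar> \<le> exp (\<alpha> * t) * (c + 1 / real (Suc n))" for n
  proof -
    have vb: "\<kappa> x * \<bar>v n x\<bar> \<le> c + 1 / real (Suc n)" for x
    proof -
      have "\<kappa> x * \<bar>v n x\<bar> \<le> \<kappa> x * (\<bar>u x\<bar> + \<bar>u x - v n x\<bar>)"
        using kappa_pos[of x] by (intro mult_left_mono) auto
      then show ?thesis
        using c[of x] v(2)[of x n] by (simp add: distrib_left)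
    qed
    have nonneg: "0 \<le> c + 1 / real (Suc n)"
      using vb[of x] kappa_pos[of x] by (meson abs_ge_zero less_imp_le mult_nonneg_nonneg order_trans)
    have "weighted_norm \<kappa> (S l t (v n)) \<le> ennreal (exp (\<alpha> * t)) * weighted_norm \<kappa> (v n)"
      by (rule norm_growth[OF l t v(1)])
    also have "\<dots> \<le> ennreal (exp (\<alpha> * t)) * ennreal (c + 1 / real (Suc n))"
      using vb nonneg by (intro mult_left_mono) (simp_all add: weighted_norm_le_real)
    also have "\<dots> = ennreal (exp (\<alpha> * t) * (c + 1 / real (Suc n)))"
      using nonneg by (simp add: ennreal_mult)
    finally show ?thesis
      using nonneg by (subst (asm) weighted_norm_le_real) auto
  qed
  then have "\<kappa> x * \<bar>S l t u x\<bar> \<le> exp (\<alpha> * t) * (c + 0)"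
    by (intro LIMSEQ_le[OF lim lim']) blast
  then show ?thesis
    by simp
qed

lemma S_sublinear: "l \<in> \<Lambda> \<Longrightarrow> 0 \<le> t \<Longrightarrow> sublinear_operator (exp (\<alpha> * t)) (S l t)"
  unfolding sublinear_operator_def
proof (intro conjI ballI allI impI mono_onI)
  assume l: "l \<in> \<Lambda>" and t: "0 \<le> t"
  fix u v assume uv: "u \<in> UC \<kappa>" "v \<in> UC \<kappa>"
  show "S l t (\<lambda>x. u x + v x) x \<le> S l t u x + S l t v x" for x
    using S_lincomb[OF l t uv, of 1 1] by simp
next
  assume l: "l \<in> \<Lambda>" and t: "0 \<le> t"
  fix u and a :: real assume u: "u \<in> UC \<kappa>"
  show "S l t (\<lambda>x. a * u x) = (\<lambda>x. a * S l t u x)"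
    using S_lincomb[OF l t u u, of a 0] by simp
next
  assume l: "l \<in> \<Lambda>" and t: "0 \<le> t"
  fix u v assume "range v \<subseteq> UC \<kappa> \<and> u \<in> UC \<kappa> \<and> increases_to v u"
  then show "increases_to (\<lambda>n. S l t (v n)) (S l t u)"
    using S_feller[OF l] t by (auto simp: feller_semigroup_def)
qed (simp_all add: S_UC S_mono S_bound)

text \<open>
  These bounds do not depend on \<open>l\<close>. The sup bound follows from comparison with constants, which the
  semigroups fix, and the Lipschitz bound from the growth bound for \<open>Lip_norm\<close>.
\<close>

lemma S_Lip_b_uniform:
  assumes u: "u \<in> Lip_b" and t: "0 \<le> t"
  shows "\<exists>b K. 0 \<le> K \<and> (\<forall>l\<in>\<Lambda>. \<forall>x. \<bar>S l t u x\<bar> \<le> b) \<and>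
    (\<forall>l\<in>\<Lambda>. \<forall>x y. \<bar>S l t u x - S l t u y\<bar> \<le> K * dist x y)"
proof -
  obtain b where b: "\<And>x. \<bar>u x\<bar> \<le> b"
    using u by (auto simp: Lip_b_def bounded_iff)
  obtain L where L: "L-lipschitz_on UNIV u"
    using u by (auto simp: Lip_b_def)
  then have L0: "0 \<le> L"
    by (rule lipschitz_on_nonneg)
  note uUC = Lip_b_in_UC[OF u] and cUC = Lip_b_in_UC[OF const_in_Lip_b]
  have bound: "\<bar>S l t u x\<bar> \<le> b" if l: "l \<in> \<Lambda>" for l x
  proof -
    have "u \<le> (\<lambda>x. b)" "(\<lambda>x. - b) \<le> u"
      using b by (auto intro!: le_funI simp: abs_le_iff minus_le_iff)
    then have "S l t u x \<le> b" "- b \<le> S l t u x"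
      using le_funD[OF S_mono[OF l t uUC cUC], of b x] le_funD[OF S_mono[OF l t cUC uUC], of "- b" x]
      by (simp_all add: S_const[OF l t])
    then show ?thesis
      by linarith
  qed
  have lip: "\<bar>S l t u x - S l t u y\<bar> \<le> (exp (\<beta> * t) * L + 1) * dist x y" if l: "l \<in> \<Lambda>" for l x y
  proof -
    have "Lip_norm (S l t u) \<le> ennreal (exp (\<beta> * t)) * Lip_norm u"
      by (rule Lip_growth[OF l t u])
    also have "\<dots> \<le> ennreal (exp (\<beta> * t)) * ennreal L"
      unfolding Lip_norm_def by (intro mult_left_mono Inf_lower) (use L in auto)
    also have "\<dots> = ennreal (exp (\<beta> * t) * L)"
      using L0 by (simp add: ennreal_mult)
    \<comment> \<open>\<open>Lip_norm\<close> is an infimum; a strict upper bound is needed to extract an actual Lipschitz constant.\<close>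
    also have "\<dots> < ennreal (exp (\<beta> * t) * L + 1)"
      using L0 by (intro ennreal_lessI) (simp_all add: add_nonneg_pos)
    finally obtain y where "y \<in> {ennreal M |M. M-lipschitz_on UNIV (S l t u)}" "y < ennreal (exp (\<beta> * t) * L + 1)"
      unfolding Lip_norm_def Inf_less_iff by blast
    then obtain M where M: "ennreal M < ennreal (exp (\<beta> * t) * L + 1)" "M-lipschitz_on UNIV (S l t u)"
      by blast
    then have "M \<le> exp (\<beta> * t) * L + 1"
      using ennreal_leI[of "exp (\<beta> * t) * L + 1" M] by (meson linear not_le)
    then have "(exp (\<beta> * t) * L + 1)-lipschitz_on UNIV (S l t u)"
      using M lipschitz_on_mono by blast
    then show ?thesis
      by (metis lipschitz_onD UNIV_I dist_real_def)
  qed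
  show ?thesis
    using L0 bound lip by (intro exI[of _ b] exI[of _ "exp (\<beta> * t) * L + 1"]) simp
qed

lemma sup_op_Lip_b:
  assumes u: "u \<in> Lip_b" and t: "0 \<le> t"
  shows "sup_op \<Lambda> S t u \<in> Lip_b"
proof -
  obtain b K where K: "0 \<le> K" and b: "\<And>l x. l \<in> \<Lambda> \<Longrightarrow> \<bar>S l t u x\<bar> \<le> b"
    and lip: "\<And>l x y. l \<in> \<Lambda> \<Longrightarrow> \<bar>S l t u x - S l t u y\<bar> \<le> K * dist x y"
    using S_Lip_b_uniform[OF u t] by metis
  have bdd: "bdd_above ((\<lambda>l. S l t u x) ` \<Lambda>)" for x
    using b by (intro bdd_aboveI2[of _ _ b]) (simp add: abs_le_iff)
  have "\<bar>sup_op \<Lambda> S t u x - sup_op \<Lambda> S t u y\<bar> \<le> K * dist x y" for x y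
    unfolding sup_op_def by (rule abs_SUP_diff_le[OF nonempty bdd bdd lip])
  then have "K-lipschitz_on UNIV (sup_op \<Lambda> S t u)"
    using K by (intro lipschitz_onI) (auto simp: dist_real_def)
  moreover have "\<bar>sup_op \<Lambda> S t u x\<bar> \<le> b" for x
    using abs_SUP_diff_le[of \<Lambda> "\<lambda>l. S l t u x" "\<lambda>l. 0" b] nonempty bdd b
    by (simp add: sup_op_def bdd_aboveI2[of _ _ 0])
  ultimately show ?thesis
    by (force simp: Lip_b_def bounded_iff)
qed

lemma sup_op_sublinear:
  assumes "0 \<le> t"
  shows "sublinear_operator (exp (\<alpha> * t)) (sup_op \<Lambda> S t)"
  unfolding sup_op_def
proof (rule sublinear_operator_SUP[OF nonempty S_sublinear[OF _ assms]])
  show "(\<lambda>x. SUP l\<in>\<Lambda>. S l t u x) \<in> UC \<kappa>" if "u \<in> UC \<kappa>" for u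
    using sup_op_Lip_b[OF _ assms]
    by (intro SUP_in_UC[OF nonempty _ S_sublinear[OF _ assms] _ that]) (auto simp: sup_op_def Lip_b_in_UC)
qed

text \<open>
  Splitting a step lets the index be chosen anew at the intermediate time, which can only increase
  the supremum.
\<close>

lemma sup_op_add_le:
  assumes s: "0 \<le> s" and t: "0 \<le> t" and u: "u \<in> UC \<kappa>"
  shows "sup_op \<Lambda> S (s + t) u \<le> sup_op \<Lambda> S s (sup_op \<Lambda> S t u)"
proof (rule le_funI)
  fix x
  note tu = sublinear_operator_UC[OF sup_op_sublinear[OF t] u]
  show "sup_op \<Lambda> S (s + t) u x \<le> sup_op \<Lambda> S s (sup_op \<Lambda> S t u) x"
    unfolding sup_op_def[of _ _ "s + t"]
  proof (rule cSUP_least[OF nonempty])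
    fix l assume l: "l \<in> \<Lambda>"
    have "S l (s + t) u x = S l s (S l t u) x"
      using S_feller[OF l] s t u by (simp add: feller_semigroup_def)
    also have "\<dots> \<le> S l s (sup_op \<Lambda> S t u) x"
    proof -
      have "S l t u y \<le> sup_op \<Lambda> S t u y" for y
        unfolding sup_op_def
        by (rule cSUP_upper[OF l sublinear_operators_bdd_above[OF S_sublinear[OF _ t] u]])
      then show ?thesis
        using S_mono[OF l s S_UC[OF l t u] tu] by (simp add: le_fun_def)
    qed
    also have "\<dots> \<le> sup_op \<Lambda> S s (sup_op \<Lambda> S t u) x"
      unfolding sup_op_def[of _ _ s]
      by (rule cSUP_upper[OF l sublinear_operators_bdd_above[OF S_sublinear[OF _ s] tu]])
    finally show "S l (s + t) u x \<le> sup_op \<Lambda> S s (sup_op \<Lambda> S t u) x" .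
  qed
qed

lemma sup_op_list_sublinear:
  assumes "sorted ts" "ts \<noteq> []"
  shows "sublinear_operator (exp (\<alpha> * (last ts - hd ts))) (sup_op_list \<Lambda> S ts)"
  using assms
proof (induction ts rule: induct_list012)
  case (2 a)
  have "sup_op_list \<Lambda> S [a] = (\<lambda>u. u)"
    by (simp add: fun_eq_iff)
  then show ?case
    using sublinear_operator_id by simp
next
  case (3 a b ts)
  have "sublinear_operator (exp (\<alpha> * (b - a)) * exp (\<alpha> * (last (b # ts) - b)))
      (\<lambda>u. sup_op \<Lambda> S (b - a) (sup_op_list \<Lambda> S (b # ts) u))"
    using 3 by (intro sublinear_operator_comp sup_op_sublinear) auto
  then show ?case
    by (simp add: algebra_simps flip: exp_add)
qed simp

text \<open>
  The new time splits exactly one step, where \<open>sup_op_add_le\<close> applies; monotonicity carries the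
  inequality through the operators to the left of that step.
\<close>

lemma sup_op_list_insort:
  assumes "sorted ts" "ts \<noteq> []" "s \<notin> set ts" "hd ts \<le> s" "s \<le> last ts" "u \<in> UC \<kappa>"
  shows "sup_op_list \<Lambda> S ts u \<le> sup_op_list \<Lambda> S (insort s ts) u"
  using assms
proof (induction ts rule: induct_list012)
  case (3 a b ts)
  then have less: "a \<le> b" "a < s" "s \<noteq> b" by auto
  have ts: "sorted (b # ts)" using 3 by simp
  note bts = sublinear_operator_UC[OF sup_op_list_sublinear[OF ts] \<open>u \<in> UC \<kappa>\<close>]
  show ?case
  proof (cases "s < b")
    case True
    then show ?thesis
      using less sup_op_add_le[of "s - a" "b - s", OF _ _ bts] by simp
  next
    case False
    then have b: "b < s" using less by simp
    have "sup_op_list \<Lambda> S (b # ts) u \<le> sup_op_list \<Lambda> S (insort s (b # ts)) u"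
      using 3 b by (intro "3.IH"(2)) auto
    moreover have "sup_op_list \<Lambda> S (insort s (b # ts)) u \<in> UC \<kappa>"
      using ts by (intro sublinear_operator_UC[OF sup_op_list_sublinear] sorted_insort[THEN iffD2] \<open>u \<in> UC \<kappa>\<close>) auto
    ultimately have "sup_op \<Lambda> S (b - a) (sup_op_list \<Lambda> S (b # ts) u)
        \<le> sup_op \<Lambda> S (b - a) (sup_op_list \<Lambda> S (insort s (b # ts)) u)"
      using less by (intro sublinear_operator_mono[OF sup_op_sublinear] bts) auto
    then show ?thesis
      using less b by simp
  qed
qed auto

lemma sup_op_partition_sublinear:
  "\<pi> \<in> partitions t \<Longrightarrow> sublinear_operator (exp (\<alpha> * t)) (sup_op_partition \<Lambda> S \<pi>)"
  using sup_op_list_sublinear[of "sorted_list_of_set \<pi>"] partitions_hd_last[of \<pi> t]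
  by (simp add: sup_op_partition_def[abs_def])

lemma sup_op_partition_refine:
  assumes \<pi>: "\<pi> \<in> partitions t" and F: "finite F" "F \<subseteq> {0..t}" and u: "u \<in> UC \<kappa>"
  shows "sup_op_partition \<Lambda> S \<pi> u \<le> sup_op_partition \<Lambda> S (\<pi> \<union> F) u"
  using F
proof (induction F)
  case (insert s F)
  then have \<pi>F: "\<pi> \<union> F \<in> partitions t"
    using \<pi> by (intro partitions_Un) auto
  have "sup_op_partition \<Lambda> S (\<pi> \<union> F) u \<le> sup_op_partition \<Lambda> S (insert s (\<pi> \<union> F)) u"
  proof (cases "s \<in> \<pi> \<union> F")
    case False
    have fin: "finite (\<pi> \<union> F)"
      using \<pi>F by (simp add: partitions_def)
    have "sup_op_list \<Lambda> S (sorted_list_of_set (\<pi> \<union> F)) u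
        \<le> sup_op_list \<Lambda> S (insort s (sorted_list_of_set (\<pi> \<union> F))) u"
    proof (rule sup_op_list_insort[OF _ _ _ _ _ u])
      show "s \<notin> set (sorted_list_of_set (\<pi> \<union> F))"
        using False unfolding set_sorted_list_of_set[OF fin] .
    qed (use insert.prems partitions_hd_last[OF \<pi>F] in simp_all)
    then show ?thesis
      using sorted_list_of_set_insert[OF fin False] by (simp add: sup_op_partition_def)
  qed (simp add: insert_absorb)
  then show ?case
    using insert by (simp add: order_trans)
qed simp

end

section \<open>The semigroup law for the envelope\<close>

locale continuous_envelope = markov_family \<kappa> \<Lambda> S \<alpha> \<beta>
  for \<kappa> :: "'a::metric_space \<Rightarrow> real" and \<Lambda> :: "'l set" and S \<alpha> \<beta> +
  assumes separable: "separable_space (euclidean :: 'a topology)"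
    and envelope_continuous: "u \<in> UC \<kappa> \<Longrightarrow>
          continuous_map (top_of_set {0..}) (UC_topology \<kappa>) (\<lambda>t. envelope \<Lambda> S t u)"
begin

lemma envelope_UC: "u \<in> UC \<kappa> \<Longrightarrow> 0 \<le> t \<Longrightarrow> envelope \<Lambda> S t u \<in> UC \<kappa>"
  using continuous_map_image_subset_topspace[OF envelope_continuous, of u]
  by (auto simp: topspace_UC_topology[OF kappa_pos])

text \<open>
  As a supremum of sublinear operators; that it maps into \<open>UC \<kappa>\<close> is part of its assumed
  continuity in time.
\<close>

lemma envelope_sublinear:
  assumes "0 \<le> t"
  shows "sublinear_operator (exp (\<alpha> * t)) (envelope \<Lambda> S t)"
  unfolding envelope_def
  by (rule sublinear_operator_SUP[OF partitions_nonempty[OF assms] sup_op_partition_sublinear])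
     (use envelope_UC[OF _ assms] in \<open>auto simp: envelope_def\<close>)

lemma partition_bdd_above: "u \<in> UC \<kappa> \<Longrightarrow> bdd_above ((\<lambda>\<pi>. sup_op_partition \<Lambda> S \<pi> u x) ` partitions t)"
  by (rule sublinear_operators_bdd_above[OF sup_op_partition_sublinear])

lemma partition_le_envelope:
  "\<pi> \<in> partitions t \<Longrightarrow> u \<in> UC \<kappa> \<Longrightarrow> sup_op_partition \<Lambda> S \<pi> u \<le> envelope \<Lambda> S t u"
  unfolding envelope_def by (rule le_funI) (rule cSUP_upper[OF _ partition_bdd_above])

lemma envelope_le:
  assumes "0 \<le> t" and "\<And>\<pi>. \<pi> \<in> partitions t \<Longrightarrow> sup_op_partition \<Lambda> S \<pi> u \<le> v"
  shows "envelope \<Lambda> S t u \<le> v"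
  unfolding envelope_def
  by (rule le_funI) (rule cSUP_least[OF partitions_nonempty[OF assms(1)]], use assms(2) in \<open>simp add: le_fun_def\<close>)

text \<open>
  Partitions are directed by inclusion and refinement increases the operators.
\<close>

lemma envelope_limit_of_partitions:
  assumes u: "u \<in> UC \<kappa>" and t: "0 \<le> t"
  obtains \<pi> :: "nat \<Rightarrow> real set" where "range \<pi> \<subseteq> partitions t"
    "increases_to (\<lambda>n. sup_op_partition \<Lambda> S (\<pi> n) u) (envelope \<Lambda> S t u)"
proof -
  have "\<exists>\<pi>. range \<pi> \<subseteq> partitions t \<and>
      increases_to (\<lambda>n::nat. sup_op_partition \<Lambda> S (\<pi> n) u) (envelope \<Lambda> S t u)"
  proof (rule directed_sup_attained_by_sequence[OF separable partitions_nonempty[OF t]])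
    show "continuous_on UNIV (sup_op_partition \<Lambda> S \<pi> u)" if "\<pi> \<in> partitions t" for \<pi>
      using sublinear_operator_UC[OF sup_op_partition_sublinear[OF that] u] by (rule UC_continuous)
    show "continuous_on UNIV (envelope \<Lambda> S t u)"
      using envelope_UC[OF u t] by (rule UC_continuous)
    show "bdd_above ((\<lambda>\<pi>. sup_op_partition \<Lambda> S \<pi> u x) ` partitions t)" for x
      by (rule partition_bdd_above[OF u])
    show "envelope \<Lambda> S t u x = (SUP \<pi>\<in>partitions t. sup_op_partition \<Lambda> S \<pi> u x)" for x
      by (simp add: envelope_def)
    fix \<pi> \<rho> assume \<pi>: "\<pi> \<in> partitions t" and \<rho>: "\<rho> \<in> partitions t"
    have sub: "finite \<pi>" "\<pi> \<subseteq> {0..t}" "finite \<rho>" "\<rho> \<subseteq> {0..t}"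
      using \<pi> \<rho> partitions_le[OF \<pi>] partitions_le[OF \<rho>] by (auto simp: partitions_def)
    show "\<exists>\<sigma>\<in>partitions t. sup_op_partition \<Lambda> S \<pi> u \<le> sup_op_partition \<Lambda> S \<sigma> u \<and>
        sup_op_partition \<Lambda> S \<rho> u \<le> sup_op_partition \<Lambda> S \<sigma> u"
      using partitions_Un[OF \<pi> sub(3,4)] sup_op_partition_refine[OF \<pi> sub(3,4) u]
        sup_op_partition_refine[OF \<rho> sub(1,2) u]
      by (auto simp: Un_commute)
  qed
  then show thesis
    using that by blast
qed

lemma envelope_add:
  assumes s: "0 \<le> s" and t: "0 \<le> t" and u: "u \<in> UC \<kappa>"
  shows "envelope \<Lambda> S (s + t) u = envelope \<Lambda> S s (envelope \<Lambda> S t u)"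
proof (rule order_antisym)
  note tu = envelope_UC[OF u t]
  show "envelope \<Lambda> S (s + t) u \<le> envelope \<Lambda> S s (envelope \<Lambda> S t u)"
  proof (rule envelope_le)
    fix \<pi> assume \<pi>: "\<pi> \<in> partitions (s + t)"
    have "\<pi> \<union> {s} \<in> partitions (s + t)"
      using \<pi> s t by (intro partitions_Un) auto
    then obtain \<rho> \<sigma> where \<rho>: "\<rho> \<in> partitions s" and \<sigma>: "\<sigma> \<in> partitions t" and eq: "\<pi> \<union> {s} = \<rho> \<union> (+) s ` \<sigma>"
      using partitions_split[of "\<pi> \<union> {s}" s t] t by blast
    have "sup_op_partition \<Lambda> S \<pi> u \<le> sup_op_partition \<Lambda> S (\<pi> \<union> {s}) u"
      using s t by (intro sup_op_partition_refine[OF \<pi>] u) auto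
    also have "\<dots> = sup_op_partition \<Lambda> S \<rho> (sup_op_partition \<Lambda> S \<sigma> u)"
      unfolding eq by (rule sup_op_partition_concat[OF \<rho> \<sigma>])
    also have "\<dots> \<le> sup_op_partition \<Lambda> S \<rho> (envelope \<Lambda> S t u)"
      by (intro sublinear_operator_mono[OF sup_op_partition_sublinear[OF \<rho>]] tu
          sublinear_operator_UC[OF sup_op_partition_sublinear[OF \<sigma>]] u partition_le_envelope \<sigma>)
    also have "\<dots> \<le> envelope \<Lambda> S s (envelope \<Lambda> S t u)"
      by (rule partition_le_envelope[OF \<rho> tu])
    finally show "sup_op_partition \<Lambda> S \<pi> u \<le> envelope \<Lambda> S s (envelope \<Lambda> S t u)" .
  qed (use s t in simp)
  obtain \<pi> :: "nat \<Rightarrow> real set" where \<pi>: "range \<pi> \<subseteq> partitions t"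
    and lim: "increases_to (\<lambda>n. sup_op_partition \<Lambda> S (\<pi> n) u) (envelope \<Lambda> S t u)"
    using envelope_limit_of_partitions[OF u t] by blast
  show "envelope \<Lambda> S s (envelope \<Lambda> S t u) \<le> envelope \<Lambda> S (s + t) u"
  proof (rule envelope_le[OF s], rule le_funI)
    fix \<rho> x assume \<rho>: "\<rho> \<in> partitions s"
    have \<pi>n: "\<pi> n \<in> partitions t" for n
      using \<pi> by blast
    have "increases_to (\<lambda>n. sup_op_partition \<Lambda> S \<rho> (sup_op_partition \<Lambda> S (\<pi> n) u))
        (sup_op_partition \<Lambda> S \<rho> (envelope \<Lambda> S t u))"
      using sublinear_operator_UC[OF sup_op_partition_sublinear[OF \<pi>n] u]
      by (intro sublinear_operator_from_below[OF sup_op_partition_sublinear[OF \<rho>] _ tu lim]) auto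
    then have "(\<lambda>n. sup_op_partition \<Lambda> S \<rho> (sup_op_partition \<Lambda> S (\<pi> n) u) x)
        \<longlonglongrightarrow> sup_op_partition \<Lambda> S \<rho> (envelope \<Lambda> S t u) x"
      by (simp add: increases_to_def)
    moreover have "sup_op_partition \<Lambda> S \<rho> (sup_op_partition \<Lambda> S (\<pi> n) u) x \<le> envelope \<Lambda> S (s + t) u x" for n
      using partition_le_envelope[OF sup_op_partition_concat(1)[OF \<rho> \<pi>n] u, of n]
      unfolding sup_op_partition_concat(2)[OF \<rho> \<pi>n] by (rule le_funD)
    ultimately show "sup_op_partition \<Lambda> S \<rho> (envelope \<Lambda> S t u) x \<le> envelope \<Lambda> S (s + t) u x"
      by (intro LIMSEQ_le_const2) auto
  qed
qed

section \<open>Small-time limits\<close>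

text \<open>
  The Lipschitz constants \<open>exp (\<alpha> * h)\<close> are bounded by \<open>exp \<bar>\<alpha>\<bar>\<close> for \<open>h \<le> 1\<close>, so \<open>w h\<close> may be replaced by
  its limit \<open>v\<close>; the rest is strong continuity at time \<open>0\<close>.
\<close>

lemma envelope_tendsto:
  assumes lim: "limitin (UC_topology \<kappa>) w v (at_right 0)"
  shows "((\<lambda>h. envelope \<Lambda> S h (w h) x) \<longlongrightarrow> v x) (at_right 0)"
proof -
  have v: "v \<in> UC \<kappa>" and w: "\<forall>\<^sub>F h in at_right 0. w h \<in> UC \<kappa>"
    and close: "\<And>e. 0 < e \<Longrightarrow> \<forall>\<^sub>F h in at_right 0. \<forall>x. \<kappa> x * \<bar>w h x - v x\<bar> \<le> e"
    using lim unfolding limitin_UC_iff by blast+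
  have h1: "\<forall>\<^sub>F h in at_right 0. 0 < h \<and> h < (1::real)"
    using eventually_at_right_less[of "0::real"] eventually_at_right_real[of 0 "1::real"] by (auto elim: eventually_elim2)
  have "((\<lambda>h. envelope \<Lambda> S h (w h) x - envelope \<Lambda> S h v x) \<longlongrightarrow> 0) (at_right 0)"
  proof (rule tendstoI)
    fix r :: real assume r: "0 < r"
    define e where "e = r * \<kappa> x / (2 * exp \<bar>\<alpha>\<bar>)"
    have e: "0 < e" "exp \<bar>\<alpha>\<bar> * e = \<kappa> x * (r / 2)"
      using r kappa_pos[of x] by (simp_all add: e_def)
    show "\<forall>\<^sub>F h in at_right 0. dist (envelope \<Lambda> S h (w h) x - envelope \<Lambda> S h v x) 0 < r"
      using close[OF e(1)] w h1
    proof eventually_elim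
      case (elim h)
      then have "\<kappa> x * \<bar>envelope \<Lambda> S h (w h) x - envelope \<Lambda> S h v x\<bar> \<le> exp (\<alpha> * h) * e"
        by (intro sublinear_operator_lipschitz[OF envelope_sublinear _ v]) auto
      also have "\<dots> \<le> exp \<bar>\<alpha>\<bar> * e"
      proof -
        have "\<alpha> * h \<le> \<bar>\<alpha>\<bar> * 1"
          using elim by (intro mult_mono) auto
        then show ?thesis
          using e by simp
      qed
      finally have "\<bar>envelope \<Lambda> S h (w h) x - envelope \<Lambda> S h v x\<bar> \<le> r / 2"
        unfolding e(2) using kappa_pos[of x] by simp
      then show ?case
        using r by simp
    qed
  qed
  moreover have "((\<lambda>h. envelope \<Lambda> S h v x) \<longlongrightarrow> v x) (at_right 0)"
  proof -
    have "limitin (top_of_set {0..}) (\<lambda>h. h) (0::real) (at_right 0)"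
      using h1 by (auto simp: limitin_subtopology elim: eventually_mono)
    then have "limitin (UC_topology \<kappa>) ((\<lambda>h. envelope \<Lambda> S h v) \<circ> (\<lambda>h. h)) (envelope \<Lambda> S 0 v) (at_right 0)"
      by (rule continuous_map_limit[OF envelope_continuous[OF v]])
    then show ?thesis
      using limitin_UC_pointwise[of "\<lambda>h. envelope \<Lambda> S h v" v "at_right 0" x]
      by (simp add: envelope_0 o_def)
  qed
  ultimately show ?thesis
    using tendsto_add by fastforce
qed

lemma test_class_tendsto:
  assumes "u \<in> test_class \<kappa> \<Lambda> S"
  shows "((\<lambda>h. (envelope \<Lambda> S h u x - u x) / h) \<longlongrightarrow> sup_generator \<kappa> \<Lambda> S u x) (at_right 0)"
proof (rule tendstoI)
  let ?d = "\<lambda>h x. (envelope \<Lambda> S h u x - u x) / h - sup_generator \<kappa> \<Lambda> S u x"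
  fix e :: real assume e: "0 < e"
  have "((\<lambda>h. weighted_norm \<kappa> (?d h)) \<longlongrightarrow> 0) (at_right 0)"
    using assms by (simp add: test_class_def)
  moreover have "0 < ennreal (\<kappa> x * (e / 2))"
    using e kappa_pos[of x] by simp
  ultimately have "\<forall>\<^sub>F h in at_right 0. weighted_norm \<kappa> (?d h) < ennreal (\<kappa> x * (e / 2))"
    by (rule order_tendstoD(2))
  then show "\<forall>\<^sub>F h in at_right 0. dist ((envelope \<Lambda> S h u x - u x) / h) (sup_generator \<kappa> \<Lambda> S u x) < e"
  proof eventually_elim
    case (elim h)
    then have "\<kappa> x * \<bar>?d h x\<bar> \<le> \<kappa> x * (e / 2)"
      using weighted_norm_le_real[of "\<kappa> x * (e / 2)" "?d h"] e kappa_pos[of x] by (simp add: less_imp_le)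
    then have "\<bar>?d h x\<bar> \<le> e / 2"
      using kappa_pos[of x] by (meson mult_le_cancel_left_pos)
    then show ?case
      using e by (simp add: dist_real_def)
  qed
qed

text \<open>
  The viscosity inequalities look back from time \<open>t\<close> to \<open>t - h\<close>, since \<open>u t\<close> is obtained by evolving
  \<open>u (t - h)\<close> over the time \<open>h\<close>.
\<close>

lemma backward_difference_quotient:
  assumes "has_UC_derivative \<kappa> \<psi> v t"
  shows "limitin (UC_topology \<kappa>) (\<lambda>h x. (\<psi> t x - \<psi> (t - h) x) / h) v (at_right 0)"
proof -
  have "filterlim (\<lambda>h. - h) (at 0) (at_right (0::real))"
    by (intro filterlim_atI tendsto_eq_intros) (auto simp: eventually_at_filter)
  from eventually_compose_filterlim[OF _ this]
  have "limitin (UC_topology \<kappa>) (\<lambda>h x. (\<psi> (t + - h) x - \<psi> t x) / - h) v (at_right 0)"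
    using assms unfolding has_UC_derivative_def limitin_def by blast
  moreover have "(\<psi> (t + - h) x - \<psi> t x) / - h = (\<psi> t x - \<psi> (t - h) x) / h" for h x
    by (simp add: minus_divide_left flip: minus_divide_right)
  ultimately show ?thesis
    by (simp only:)
qed

section \<open>The viscosity inequalities\<close>

text \<open>
  Evolving \<open>u (t - h) \<le> \<psi> (t - h)\<close> over the time \<open>h\<close> returns \<open>u t\<close> on the left; on the right,
  subadditivity for \<open>\<psi> (t - h) = \<psi> t + h * (- w h)\<close> separates the generator from the time derivative.
\<close>

lemma envelope_viscosity_subsolution:
  assumes u0: "u0 \<in> UC \<kappa>"
  shows "viscosity_subsolution \<kappa> (test_class \<kappa> \<Lambda> S) (sup_generator \<kappa> \<Lambda> S) (\<lambda>t. envelope \<Lambda> S t u0)"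
  unfolding viscosity_subsolution_def
proof (intro conjI allI impI)
  fix t x \<psi> \<psi>' assume t: "0 < t"
    and H: "differentiable_with \<kappa> \<psi> \<psi>' \<and> \<psi> t \<in> test_class \<kappa> \<Lambda> S \<and> \<psi> t x = envelope \<Lambda> S t u0 x \<and>
      (\<forall>s>0. envelope \<Lambda> S s u0 \<le> \<psi> s)"
  define w where "w h = (\<lambda>x. (\<psi> t x - \<psi> (t - h) x) / h)" for h
  have \<psi>UC: "\<psi> s \<in> UC \<kappa>" if "0 < s" for s
    using H that by (simp add: differentiable_with_def)
  have w: "limitin (UC_topology \<kappa>) w (\<psi>' t) (at_right 0)"
    using H t backward_difference_quotient[of \<psi> "\<psi>' t" t] by (simp add: differentiable_with_def w_def[abs_def])
  have minus_w: "limitin (UC_topology \<kappa>) (\<lambda>h x. - w h x) (\<lambda>x. - \<psi>' t x) (at_right 0)"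
    using w UC_lincomb[of _ _ "-1" 0] unfolding limitin_UC_iff
    by (auto simp: abs_minus_commute elim: eventually_mono)
  have lim: "((\<lambda>h. (envelope \<Lambda> S h (\<psi> t) x - \<psi> t x) / h + envelope \<Lambda> S h (\<lambda>x. - w h x) x)
      \<longlongrightarrow> sup_generator \<kappa> \<Lambda> S (\<psi> t) x + - \<psi>' t x) (at_right 0)"
    using H by (intro tendsto_add test_class_tendsto envelope_tendsto[OF minus_w]) auto
  have "\<forall>\<^sub>F h in at_right 0. h < t" "\<forall>\<^sub>F h in at_right 0. 0 < (h::real)" "\<forall>\<^sub>F h in at_right 0. w h \<in> UC \<kappa>"
    using t w eventually_at_right_real[of 0 t] by (auto simp: eventually_at_right_less limitin_UC_iff elim: eventually_mono)
  then have "\<forall>\<^sub>F h in at_right 0. 0 \<le> (envelope \<Lambda> S h (\<psi> t) x - \<psi> t x) / h + envelope \<Lambda> S h (\<lambda>x. - w h x) x"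
  proof eventually_elim
    case (elim h)
    have mw: "(\<lambda>x. - w h x) \<in> UC \<kappa>" and hmw: "(\<lambda>x. h * - w h x) \<in> UC \<kappa>"
      using UC_lincomb[OF elim(3) elim(3), of "-1" 0] UC_lincomb[OF elim(3) elim(3), of "-h" 0] by simp_all
    have T: "sublinear_operator (exp (\<alpha> * h)) (envelope \<Lambda> S h)"
      using elim by (intro envelope_sublinear) simp
    have shift: "\<psi> (t - h) = (\<lambda>x. \<psi> t x + h * - w h x)"
      using elim by (simp add: w_def fun_eq_iff)
    have "\<psi> t x = envelope \<Lambda> S h (envelope \<Lambda> S (t - h) u0) x"
      using H elim envelope_add[of h "t - h" u0] u0 by simp
    also have "\<dots> \<le> envelope \<Lambda> S h (\<psi> (t - h)) x"
      using H elim \<psi>UC envelope_UC[OF u0] by (intro le_funD[OF sublinear_operator_mono[OF T]]) auto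
    also have "\<dots> \<le> envelope \<Lambda> S h (\<psi> t) x + envelope \<Lambda> S h (\<lambda>x. h * - w h x) x"
      unfolding shift by (rule sublinear_operator_add[OF T \<psi>UC[OF t] hmw])
    also have "envelope \<Lambda> S h (\<lambda>x. h * - w h x) x = h * envelope \<Lambda> S h (\<lambda>x. - w h x) x"
      using elim by (subst sublinear_operator_scale[OF T mw]) auto
    finally show ?case
      using elim by (simp add: field_simps)
  qed
  then have "0 \<le> sup_generator \<kappa> \<Lambda> S (\<psi> t) x + - \<psi>' t x"
    by (rule tendsto_lowerbound[OF lim]) simp
  then show "\<psi>' t x \<le> sup_generator \<kappa> \<Lambda> S (\<psi> t) x"
    by simp
qed (rule envelope_continuous[OF u0])

text \<open>
  Subadditivity bounds \<open>T h\<close> of a sum only from above, so here \<open>\<psi> t\<close>, and not \<open>\<psi> (t - h)\<close>, is the function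
  to decompose.
\<close>

lemma envelope_viscosity_supersolution:
  assumes u0: "u0 \<in> UC \<kappa>"
  shows "viscosity_supersolution \<kappa> (test_class \<kappa> \<Lambda> S) (sup_generator \<kappa> \<Lambda> S) (\<lambda>t. envelope \<Lambda> S t u0)"
  unfolding viscosity_supersolution_def
proof (intro conjI allI impI)
  fix t x \<psi> \<psi>' assume t: "0 < t"
    and H: "differentiable_with \<kappa> \<psi> \<psi>' \<and> \<psi> t \<in> test_class \<kappa> \<Lambda> S \<and> \<psi> t x = envelope \<Lambda> S t u0 x \<and>
      (\<forall>s>0. \<psi> s \<le> envelope \<Lambda> S s u0)"
  define w where "w h = (\<lambda>x. (\<psi> t x - \<psi> (t - h) x) / h)" for h
  have \<psi>UC: "\<psi> s \<in> UC \<kappa>" if "0 < s" for s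
    using H that by (simp add: differentiable_with_def)
  have w: "limitin (UC_topology \<kappa>) w (\<psi>' t) (at_right 0)"
    using H t backward_difference_quotient[of \<psi> "\<psi>' t" t] by (simp add: differentiable_with_def w_def[abs_def])
  have lim: "((\<lambda>h. (envelope \<Lambda> S h (\<psi> t) x - \<psi> t x) / h - envelope \<Lambda> S h (w h) x)
      \<longlongrightarrow> sup_generator \<kappa> \<Lambda> S (\<psi> t) x - \<psi>' t x) (at_right 0)"
    using H by (intro tendsto_diff test_class_tendsto envelope_tendsto[OF w]) auto
  have "\<forall>\<^sub>F h in at_right 0. h < t" "\<forall>\<^sub>F h in at_right 0. 0 < (h::real)" "\<forall>\<^sub>F h in at_right 0. w h \<in> UC \<kappa>"
    using t w eventually_at_right_real[of 0 t] by (auto simp: eventually_at_right_less limitin_UC_iff elim: eventually_mono)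
  then have "\<forall>\<^sub>F h in at_right 0. (envelope \<Lambda> S h (\<psi> t) x - \<psi> t x) / h - envelope \<Lambda> S h (w h) x \<le> 0"
  proof eventually_elim
    case (elim h)
    have hw: "(\<lambda>x. h * w h x) \<in> UC \<kappa>"
      using UC_lincomb[OF elim(3) elim(3), of h 0] by simp
    have T: "sublinear_operator (exp (\<alpha> * h)) (envelope \<Lambda> S h)"
      using elim by (intro envelope_sublinear) simp
    have th: "\<psi> (t - h) \<in> UC \<kappa>"
      using elim by (intro \<psi>UC) simp
    have "\<psi> t = (\<lambda>x. \<psi> (t - h) x + h * w h x)"
      using elim by (simp add: w_def fun_eq_iff)
    then have "envelope \<Lambda> S h (\<psi> t) x \<le> envelope \<Lambda> S h (\<psi> (t - h)) x + envelope \<Lambda> S h (\<lambda>x. h * w h x) x"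
      using sublinear_operator_add[OF T th hw, of x] by simp
    also have "envelope \<Lambda> S h (\<lambda>x. h * w h x) x = h * envelope \<Lambda> S h (w h) x"
      using elim by (subst sublinear_operator_scale[OF T]) auto
    also have "envelope \<Lambda> S h (\<psi> (t - h)) x \<le> envelope \<Lambda> S h (envelope \<Lambda> S (t - h) u0) x"
      using H elim th envelope_UC[OF u0] by (intro le_funD[OF sublinear_operator_mono[OF T]]) auto
    also have "\<dots> = \<psi> t x"
      using H elim envelope_add[of h "t - h" u0] u0 by simp
    finally show ?case
      using elim by (simp add: field_simps)
  qed
  then have "sup_generator \<kappa> \<Lambda> S (\<psi> t) x - \<psi>' t x \<le> 0"
    by (rule tendsto_upperbound[OF lim]) simp
  then show "sup_generator \<kappa> \<Lambda> S (\<psi> t) x \<le> \<psi>' t x"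
    by simp
qed (rule envelope_continuous[OF u0])

end

theorem theorem4p5:
  fixes \<Lambda> :: "'l set"
    and \<kappa> :: "'a::metric_space \<Rightarrow> real"
    and S :: "'l \<Rightarrow> real \<Rightarrow> ('a \<Rightarrow> real) \<Rightarrow> ('a \<Rightarrow> real)"
    and \<alpha> \<beta> :: real
  assumes nonempty: "\<Lambda> \<noteq> {}"
    and separable: "separable_space (euclidean :: 'a topology)"
    and kappa_pos: "\<forall>x. 0 < \<kappa> x"
    and kappa_cont: "continuous_on UNIV \<kappa>"
    and kappa_bdd: "bounded (range \<kappa>)"
    and A1_feller: "\<forall>l\<in>\<Lambda>. feller_semigroup \<kappa> (S l)"
    and A1_linear: "\<forall>l\<in>\<Lambda>. linear_family \<kappa> (S l)"
    and A1_one: "\<forall>l\<in>\<Lambda>. \<forall>t\<ge>0. S l t (\<lambda>x. 1) = (\<lambda>x. 1)"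
    and A2_norm: "\<forall>l\<in>\<Lambda>. \<forall>t\<ge>0. \<forall>u\<in>Lip_b.
          weighted_norm \<kappa> (S l t u) \<le> ennreal (exp (\<alpha> * t)) * weighted_norm \<kappa> u"
    and A2_Lip: "\<forall>l\<in>\<Lambda>. \<forall>t\<ge>0. \<forall>u\<in>Lip_b.
          Lip_norm (S l t u) \<le> ennreal (exp (\<beta> * t)) * Lip_norm u"
    and strongly_continuous: "\<forall>u\<in>UC \<kappa>.
          continuous_map (top_of_set {0..}) (UC_topology \<kappa>) (\<lambda>t. envelope \<Lambda> S t u)"
  shows "\<forall>u0\<in>UC \<kappa>.
          viscosity_solution_ivp \<kappa> (test_class \<kappa> \<Lambda> S) (sup_generator \<kappa> \<Lambda> S) u0
            (\<lambda>t. envelope \<Lambda> S t u0)"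
proof -
  interpret continuous_envelope \<kappa> \<Lambda> S \<alpha> \<beta>
    by unfold_locales (use assms in auto)
  show ?thesis
    by (simp add: viscosity_solution_ivp_def viscosity_solution_def envelope_0
        envelope_viscosity_subsolution envelope_viscosity_supersolution)
qed

end
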